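(* Let $\Omega\subset\mathbb{R}^n$ be a bounded $C^2$-smooth domain with $B_2(0)\subset\Omega$, and let $\varphi\in H^2(\Omega)$. Let $e_n$ denote the volume of the unit ball $B_1(0)\subset\mathbb{R}^n$. Then there exists a constant $C_1=C_1(\Omega,\varphi)\ge 0$ such that for every $R\in(\sqrt[4]{C_1/e_n},\infty)$ the following holds. Set $\Omega_R:=R\cdot\Omega=\{Rx: x\in\Omega\}$, define $\varphi_R\in H^2(\Omega_R)$ by $\varphi_R(x):=\varphi(x/R)$, and let $$\mathscr{D}_R:=\{v\in H^2(\Omega_R): v-\varphi_R\in H^2_0(\Omega_R)\}.$$ Then for every minimiser $u\in\mathscr{D}_R$ of $F$ on $\Omega_R$ (i.e. every minimiser of $v\mapsto\int_{\Omega_R}\left(|\Delta v|^2+1_{\{v\ne0\}}\right)\mathrm{d}x$ over $\mathscr{D}_R$), the set $\{x\in\Omega_R: u(x)=0\}$ has positive measure, and more precisely $$|\{x\in\Omega_R: u(x)=0\}|\ge (e_nR^4-C_1)\cdot R^{n-4}.$$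
   Context: $B_r(x)$ denotes the open ball of radius $r$ centred at $x$ in $\mathbb{R}^n$, $|A|$ denotes the Lebesgue measure of $A$, and $1_{\{v\neq0\}}$ is the indicator function of the set where $v\ne 0$. *)

theory Defs
  imports "HOL-Analysis.Analysis"
begin

definition partial_deriv :: "'a::euclidean_space \<Rightarrow> ('a \<Rightarrow> real) \<Rightarrow> 'a \<Rightarrow> real" where
  "partial_deriv b f x = frechet_derivative f (at x) b"

text \<open>A derivative of order \<open>k\<close> is indexed by a list of \<open>k\<close> basis vectors, so the list
  \<open>[b, c]\<close> stands for \<open>\<partial>\<^sub>b \<partial>\<^sub>c\<close>.\<close>

fun iter_partial :: "'a::euclidean_space list \<Rightarrow> ('a \<Rightarrow> real) \<Rightarrow> 'a \<Rightarrow> real" where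
  "iter_partial [] f = f"
| "iter_partial (b # ds) f = partial_deriv b (iter_partial ds f)"

primrec C_k :: "nat \<Rightarrow> ('a::euclidean_space \<Rightarrow> real) \<Rightarrow> bool" where
  "C_k 0 f \<longleftrightarrow> continuous_on UNIV f"
| "C_k (Suc k) f \<longleftrightarrow>
     (\<forall>x. f differentiable (at x)) \<and> (\<forall>b\<in>Basis. C_k k (partial_deriv b f))"

definition test_functions :: "'a::euclidean_space set \<Rightarrow> ('a \<Rightarrow> real) set" where
  "test_functions \<Omega> =
     {\<psi>. (\<forall>k. C_k k \<psi>) \<and> compact (closure {x. \<psi> x \<noteq> 0}) \<and> closure {x. \<psi> x \<noteq> 0} \<subseteq> \<Omega>}"

text \<open>A domain whose boundary is locally the graph of a \<open>C\<^sup>2\<close> function over the hyperplane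
  orthogonal to some unit vector \<open>\<nu>\<close>, with the domain on one side. A function on that hyperplane
  is represented by a function \<open>\<gamma>\<close> on the whole space, which is only evaluated at the orthogonal
  projection of \<open>x\<close>; extending it constantly along \<open>\<nu>\<close> shows that nothing is lost.\<close>

definition C2_domain :: "'a::euclidean_space set \<Rightarrow> bool" where
  "C2_domain \<Omega> \<longleftrightarrow> open \<Omega> \<and> connected \<Omega> \<and> \<Omega> \<noteq> {} \<and>
     (\<forall>p\<in>frontier \<Omega>. \<exists>r>0. \<exists>\<nu> \<gamma>. norm \<nu> = 1 \<and> C_k 2 \<gamma> \<and>
        \<Omega> \<inter> ball p r = {x \<in> ball p r. \<gamma> (x - (x \<bullet> \<nu>) *\<^sub>R \<nu>) < x \<bullet> \<nu>})"

text \<open>Functions on \<open>\<Omega>\<close> are represented by total functions; only their values on \<open>\<Omega>\<close> matter, and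
  functions that agree almost everywhere on \<open>\<Omega>\<close> are not identified.\<close>

definition L2_space :: "'a::euclidean_space set \<Rightarrow> ('a \<Rightarrow> real) set" where
  "L2_space \<Omega> =
     {f \<in> borel_measurable (lebesgue_on \<Omega>). integrable (lebesgue_on \<Omega>) (\<lambda>x. (f x)\<^sup>2)}"

definition has_weak_deriv ::
  "'a::euclidean_space set \<Rightarrow> 'a list \<Rightarrow> ('a \<Rightarrow> real) \<Rightarrow> ('a \<Rightarrow> real) \<Rightarrow> bool" where
  "has_weak_deriv \<Omega> ds u g \<longleftrightarrow> g \<in> L2_space \<Omega> \<and>
     (\<forall>\<psi>\<in>test_functions \<Omega>.
        (LINT x|lebesgue_on \<Omega>. u x * iter_partial ds \<psi> x) =
        (-1) ^ length ds * (LINT x|lebesgue_on \<Omega>. g x * \<psi> x))"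

text \<open>The space \<open>H\<^sup>k(\<Omega>)\<close>.\<close>

definition sobolev_space :: "nat \<Rightarrow> 'a::euclidean_space set \<Rightarrow> ('a \<Rightarrow> real) set" where
  "sobolev_space k \<Omega> =
     {u \<in> L2_space \<Omega>. \<forall>ds. set ds \<subseteq> Basis \<and> length ds \<le> k \<longrightarrow> (\<exists>g. has_weak_deriv \<Omega> ds u g)}"

text \<open>For \<open>u\<close> in the Sobolev space the chosen representative is unique up to a null set of \<open>\<Omega>\<close>, so
  the integrals below do not depend on the choice.\<close>

definition weak_deriv ::
  "'a::euclidean_space set \<Rightarrow> 'a list \<Rightarrow> ('a \<Rightarrow> real) \<Rightarrow> 'a \<Rightarrow> real" where
  "weak_deriv \<Omega> ds u = (SOME g. has_weak_deriv \<Omega> ds u g)"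

text \<open>For \<open>k = 2\<close> this is the square root of the integral of
  \<open>|u|\<^sup>2 + |\<nabla>u|\<^sup>2 + |D\<^sup>2u|\<^sup>2\<close>, with the Frobenius norm of the Hessian.\<close>

definition sobolev_norm :: "nat \<Rightarrow> 'a::euclidean_space set \<Rightarrow> ('a \<Rightarrow> real) \<Rightarrow> real" where
  "sobolev_norm k \<Omega> u =
     sqrt (\<Sum>ds | set ds \<subseteq> Basis \<and> length ds \<le> k. LINT x|lebesgue_on \<Omega>. (weak_deriv \<Omega> ds u x)\<^sup>2)"

text \<open>The space \<open>H\<^sup>k\<^sub>0(\<Omega>)\<close>: the closure of the test functions in \<open>H\<^sup>k(\<Omega>)\<close>.\<close>

definition sobolev_space0 :: "nat \<Rightarrow> 'a::euclidean_space set \<Rightarrow> ('a \<Rightarrow> real) set" where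
  "sobolev_space0 k \<Omega> =
     {u \<in> sobolev_space k \<Omega>. \<exists>\<psi>. (\<forall>m. \<psi> m \<in> test_functions \<Omega>) \<and>
        (\<lambda>m. sobolev_norm k \<Omega> (\<lambda>x. u x - \<psi> m x)) \<longlonglongrightarrow> 0}"

definition weak_laplacian :: "'a::euclidean_space set \<Rightarrow> ('a \<Rightarrow> real) \<Rightarrow> 'a \<Rightarrow> real" where
  "weak_laplacian \<Omega> u x = (\<Sum>b\<in>Basis. weak_deriv \<Omega> [b, b] u x)"

definition energy :: "'a::euclidean_space set \<Rightarrow> ('a \<Rightarrow> real) \<Rightarrow> real" where
  "energy \<Omega> v =
     (LINT x|lebesgue_on \<Omega>. \<bar>weak_laplacian \<Omega> v x\<bar>\<^sup>2 + indicator {y. v y \<noteq> 0} x)"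

definition dirichlet_class ::
  "'a::euclidean_space set \<Rightarrow> ('a \<Rightarrow> real) \<Rightarrow> ('a \<Rightarrow> real) set" where
  "dirichlet_class \<Omega> g =
     {v \<in> sobolev_space 2 \<Omega>. (\<lambda>x. v x - g x) \<in> sobolev_space0 2 \<Omega>}"

end

theory Submission
  imports Defs "HOL-Computational_Algebra.Polynomial"
begin

text \<open>A minimiser has at most the energy of any function with the same boundary values, and it is compared
with one that vanishes on the ball of radius \<open>R\<close>, which saves the measure \<open>e\<^sub>n R\<^sup>n\<close> of that ball in the
indicator term, \<open>e\<^sub>n\<close> being the volume of the unit ball. Let \<open>\<eta>\<close> be a smooth cutoff
function that is 1 on the unit ball and supported in the ball of radius 2, put
\<open>v\<^sub>0 = \<phi> - \<eta> \<phi>\<close>, and let \<open>C\<^sub>1\<close> be the integral of \<open>|\<Delta> v\<^sub>0|\<^sup>2\<close> over \<open>\<Omega>\<close>. The scaled function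
\<open>v(x) = v\<^sub>0(x / R)\<close> vanishes on the ball of radius \<open>R\<close>, and by scaling the integral of \<open>|\<Delta> v|\<^sup>2\<close> is
\<open>R\<^sup>n\<^sup>-\<^sup>4 C\<^sub>1\<close>. Splitting off the measure of the zero set (\<open>energy_eq\<close>), the comparison of a
minimiser \<open>u\<close> with \<open>v\<close> reads
\<open>|\<Omega>\<^sub>R| - |{u = 0}| \<le> R\<^sup>n\<^sup>-\<^sup>4 C\<^sub>1 + |\<Omega>\<^sub>R| - e\<^sub>n R\<^sup>n\<close>, which is the claim.

The analytic content is that \<open>v\<close> is an admissible competitor, that is, \<open>\<eta> u\<close> lies in the closure
of the test functions whenever \<open>u\<close> is a Sobolev function and \<open>\<eta>\<close> a test function
(\<open>mult_test_function_sobolev_space0\<close>). The product is again a Sobolev function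
(\<open>sobolev_space_mult\<close>) and has compact support in \<open>\<Omega>\<close>, so its mollifications are test functions,
their derivatives are the mollifications of its weak derivatives (\<open>has_weak_deriv_conv\<close>), and
mollifications converge in the mean square (\<open>conv_mollifier_L2\<close>). The energy and the Sobolev norm
are defined through an arbitrary choice of weak derivatives; that the choice does not matter
(\<open>has_weak_deriv_unique\<close>) is a consequence of the same convergence.

Weak derivatives of higher order are reduced to those of first order by \<open>has_weak_deriv_Cons\<close>. In
this way the product rule, the commutation with mollification and integration by parts are proved for
a single derivative and then iterated.\<close>

section \<open>Smooth functions and test functions\<close>

definition smooth :: "('a::euclidean_space \<Rightarrow> real) \<Rightarrow> bool" where
  "smooth f \<longleftrightarrow> (\<forall>k. C_k k f)"

lemma partial_deriv_eqI:
  "(f has_derivative f') (at x) \<Longrightarrow> partial_deriv b f x = f' b"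
  unfolding partial_deriv_def using frechet_derivative_at by metis

lemma has_derivative_partial_derivs:
  fixes f :: "'a::euclidean_space \<Rightarrow> real"
  assumes "f differentiable (at x)"
  shows "(f has_derivative (\<lambda>h. \<Sum>b\<in>Basis. (h \<bullet> b) * partial_deriv b f x)) (at x)"
proof -
  let ?D = "frechet_derivative f (at x)"
  have D: "(f has_derivative ?D) (at x)"
    using assms frechet_derivative_works by blast
  interpret linear ?D
    using D has_derivative_linear by blast
  have "?D h = (\<Sum>b\<in>Basis. (h \<bullet> b) * partial_deriv b f x)" for h
  proof -
    have "?D h = ?D (\<Sum>b\<in>Basis. (h \<bullet> b) *\<^sub>R b)"
      by (simp add: euclidean_representation)
    then show ?thesis
      by (simp add: sum scale partial_deriv_def)
  qed
  then have "?D = (\<lambda>h. \<Sum>b\<in>Basis. (h \<bullet> b) * partial_deriv b f x)"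
    by blast
  then show ?thesis
    using D by simp
qed

lemma smooth_differentiable: "smooth f \<Longrightarrow> f differentiable (at x)"
  unfolding smooth_def using C_k.simps(2) by blast

lemma smooth_continuous_on: "smooth f \<Longrightarrow> continuous_on S f"
  by (meson continuous_at_imp_continuous_on differentiable_imp_continuous_within
      smooth_differentiable)

lemma smooth_partial_deriv: "smooth f \<Longrightarrow> b \<in> Basis \<Longrightarrow> smooth (partial_deriv b f)"
  unfolding smooth_def using C_k.simps(2) by blast

lemma smooth_iter_partial: "smooth f \<Longrightarrow> set ds \<subseteq> Basis \<Longrightarrow> smooth (iter_partial ds f)"
  by (induction ds) (auto intro: smooth_partial_deriv)

lemma C_k_antimono: "C_k (Suc k) f \<Longrightarrow> C_k k f"
proof (induction k arbitrary: f)
  case 0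
  then show ?case
    by (auto intro!: continuous_at_imp_continuous_on differentiable_imp_continuous_within)
next
  case (Suc k)
  then show ?case by (metis C_k.simps(2))
qed

text \<open>A family of differentiable functions that is closed under partial derivatives consists of smooth
functions. This avoids an induction on the order for convolutions, whose derivatives are again
convolutions.\<close>

lemma smooth_coinduct:
  assumes "f \<in> S"
    and "\<And>f x. f \<in> S \<Longrightarrow> f differentiable (at x)"
    and "\<And>f b. f \<in> S \<Longrightarrow> b \<in> Basis \<Longrightarrow> partial_deriv b f \<in> S"
  shows "smooth f"
proof -
  have "C_k k f" if "f \<in> S" for k f
    using that
  proof (induction k arbitrary: f)
    case 0
    then show ?case
      using assms(2)
      by (auto intro!: continuous_at_imp_continuous_on differentiable_imp_continuous_within)
  qed (use assms in auto)
  then show ?thesis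
    using assms(1) unfolding smooth_def by blast
qed

lemma partial_deriv_const: "partial_deriv b (\<lambda>x. c) = (\<lambda>x. 0)"
  by (intro ext partial_deriv_eqI has_derivative_const)

lemma partial_deriv_inner: "partial_deriv b (\<lambda>x. x \<bullet> a) = (\<lambda>x. b \<bullet> a)"
  by (intro ext partial_deriv_eqI) (auto intro!: derivative_eq_intros)

lemma partial_deriv_add:
  "f differentiable (at x) \<Longrightarrow> g differentiable (at x) \<Longrightarrow>
    partial_deriv b (\<lambda>x. f x + g x) x = partial_deriv b f x + partial_deriv b g x"
  unfolding partial_deriv_def
  by (rule partial_deriv_eqI[unfolded partial_deriv_def])
     (auto intro: has_derivative_add simp: frechet_derivative_works[symmetric])

lemma partial_deriv_mult:
  fixes f g :: "'a::euclidean_space \<Rightarrow> real"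
  assumes "f differentiable (at x)" "g differentiable (at x)"
  shows "partial_deriv b (\<lambda>x. f x * g x) x = f x * partial_deriv b g x + g x * partial_deriv b f x"
proof -
  have "((\<lambda>x. f x * g x) has_derivative
      (\<lambda>h. f x * frechet_derivative g (at x) h + frechet_derivative f (at x) h * g x)) (at x)"
    using assms unfolding frechet_derivative_works by (rule has_derivative_mult)
  from partial_deriv_eqI[OF this] show ?thesis
    by (simp add: partial_deriv_def mult.commute)
qed

lemma partial_deriv_affine:
  fixes f :: "'a::euclidean_space \<Rightarrow> real"
  assumes "\<And>x. f differentiable (at x)"
  shows "partial_deriv b (\<lambda>x. f (a + c *\<^sub>R x)) = (\<lambda>x. c * partial_deriv b f (a + c *\<^sub>R x))"
proof
  fix x
  let ?D = "frechet_derivative f (at (a + c *\<^sub>R x))"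
  have D: "(f has_derivative ?D) (at (a + c *\<^sub>R x))"
    using assms frechet_derivative_works by blast
  have "((\<lambda>x. f (a + c *\<^sub>R x)) has_derivative (\<lambda>h. ?D (c *\<^sub>R h))) (at x)"
    by (rule has_derivative_compose[where f = "\<lambda>x. a + c *\<^sub>R x" and g = f, OF _ D])
       (auto intro!: derivative_eq_intros)
  from partial_deriv_eqI[OF this]
  show "partial_deriv b (\<lambda>x. f (a + c *\<^sub>R x)) x = c * partial_deriv b f (a + c *\<^sub>R x)"
    using linear_scale[OF has_derivative_linear[OF D]] by (simp add: partial_deriv_def)
qed

lemma differentiable_affine:
  fixes f :: "'a::euclidean_space \<Rightarrow> real"
  assumes "\<And>x. f differentiable (at x)"
  shows "(\<lambda>x. f (a + c *\<^sub>R x)) differentiable (at x)"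
proof -
  have "(\<lambda>x. a + c *\<^sub>R x) differentiable (at x)"
    by (auto intro!: derivative_intros)
  then show ?thesis
    using differentiable_chain_at[of "\<lambda>x. a + c *\<^sub>R x" x f] assms by (simp add: o_def)
qed

lemma C_k_const: "C_k k (\<lambda>x. c)"
  by (induction k arbitrary: c) (simp_all add: partial_deriv_const)

lemma C_k_add: "C_k k f \<Longrightarrow> C_k k g \<Longrightarrow> C_k k (\<lambda>x. f x + g x)"
proof (induction k arbitrary: f g)
  case 0
  then show ?case by (auto intro: continuous_intros)
next
  case (Suc k)
  have "partial_deriv b (\<lambda>x. f x + g x) = (\<lambda>x. partial_deriv b f x + partial_deriv b g x)" for b
    using Suc.prems by (intro ext partial_deriv_add) auto
  then show ?case
    using Suc by auto
qed

lemma C_k_mult: "C_k k f \<Longrightarrow> C_k k g \<Longrightarrow> C_k k (\<lambda>x. f x * g x)"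
proof (induction k arbitrary: f g)
  case 0
  then show ?case by (auto intro: continuous_intros)
next
  case (Suc k)
  have "partial_deriv b (\<lambda>x. f x * g x) = (\<lambda>x. f x * partial_deriv b g x + g x * partial_deriv b f x)" for b
    using Suc.prems by (intro ext partial_deriv_mult) auto
  moreover have "C_k k f" "C_k k g"
    using Suc.prems C_k_antimono by blast+
  ultimately show ?case
    using Suc by (auto intro!: C_k_add)
qed

lemma C_k_affine:
  fixes f :: "'a::euclidean_space \<Rightarrow> real"
  shows "C_k k f \<Longrightarrow> C_k k (\<lambda>x. f (a + c *\<^sub>R x))"
proof (induction k arbitrary: f)
  case 0
  show ?case
    using 0 by (auto intro!: continuous_intros continuous_on_compose2[of UNIV f])
next
  case (Suc k)
  then show ?case
    by (auto simp: partial_deriv_affine intro!: differentiable_affine C_k_mult C_k_const)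
qed

lemma C_k_inner: "C_k k (\<lambda>x. x \<bullet> a)"
proof (cases k)
  case (Suc m)
  then show ?thesis
    by (auto simp: partial_deriv_inner C_k_const intro!: derivative_intros)
qed (auto intro: continuous_intros)

lemma smooth_const: "smooth (\<lambda>x. c)"
  and smooth_mult: "smooth f \<Longrightarrow> smooth g \<Longrightarrow> smooth (\<lambda>x. f x * g x)"
  and smooth_affine: "smooth f \<Longrightarrow> smooth (\<lambda>x. f (a + c *\<^sub>R x))"
  by (simp_all add: smooth_def C_k_const C_k_mult C_k_affine)

lemma iter_partial_affine:
  assumes "smooth f" "set ds \<subseteq> Basis"
  shows "iter_partial ds (\<lambda>x. f (a + c *\<^sub>R x)) = (\<lambda>x. c ^ length ds * iter_partial ds f (a + c *\<^sub>R x))"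
  using assms(2)
proof (induction ds)
  case (Cons b ds)
  let ?g = "iter_partial ds f"
  have g: "?g differentiable (at x)" for x
    using Cons.prems assms(1) by (auto intro: smooth_differentiable smooth_iter_partial)
  have "partial_deriv b (\<lambda>x. c ^ length ds * ?g (a + c *\<^sub>R x)) x
      = c ^ length (b # ds) * iter_partial (b # ds) f (a + c *\<^sub>R x)" for x
    by (subst partial_deriv_mult)
       (auto intro!: differentiable_affine g simp: partial_deriv_affine[OF g] partial_deriv_const)
  with Cons show ?case by auto
qed simp

lemma partial_deriv_eq_0_off_closure:
  assumes "x \<notin> closure {x. f x \<noteq> 0}"
  shows "partial_deriv b f x = 0"
proof -
  have "(f has_derivative (\<lambda>h. 0)) (at x)"
  proof (rule has_derivative_transform_within_open)
    show "((\<lambda>x. 0) has_derivative (\<lambda>h. 0)) (at x)" by simp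
    show "open (- closure {x. f x \<noteq> 0})" by (simp add: open_Compl)
  qed (use assms closure_subset[of "{x. f x \<noteq> 0}"] in auto)
  then show ?thesis
    by (rule partial_deriv_eqI)
qed

text \<open>Off the closed set \<open>K\<close> the function vanishes in a whole neighbourhood, so its derivative vanishes too.\<close>

lemma partial_deriv_support:
  assumes "closed K" "\<And>x. x \<notin> K \<Longrightarrow> f x = 0" "x \<notin> K"
  shows "partial_deriv b f x = 0"
proof (rule partial_deriv_eq_0_off_closure)
  have "closure {x. f x \<noteq> 0} \<subseteq> K"
    using assms by (intro closure_minimal) auto
  with assms show "x \<notin> closure {x. f x \<noteq> 0}" by auto
qed

lemma iter_partial_support:
  assumes "closed K" "\<And>x. x \<notin> K \<Longrightarrow> f x = 0" "x \<notin> K"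
  shows "iter_partial ds f x = 0"
  using assms(3)
  by (induction ds arbitrary: x) (auto intro!: partial_deriv_support[of K] assms)

lemma test_functions_iff:
  "\<psi> \<in> test_functions \<Omega> \<longleftrightarrow> smooth \<psi> \<and> (\<exists>K. compact K \<and> K \<subseteq> \<Omega> \<and> (\<forall>x. x \<notin> K \<longrightarrow> \<psi> x = 0))"
proof
  assume "\<psi> \<in> test_functions \<Omega>"
  then show "smooth \<psi> \<and> (\<exists>K. compact K \<and> K \<subseteq> \<Omega> \<and> (\<forall>x. x \<notin> K \<longrightarrow> \<psi> x = 0))"
    using closure_subset[of "{x. \<psi> x \<noteq> 0}"] unfolding test_functions_def smooth_def by blast
next
  assume *: "smooth \<psi> \<and> (\<exists>K. compact K \<and> K \<subseteq> \<Omega> \<and> (\<forall>x. x \<notin> K \<longrightarrow> \<psi> x = 0))"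
  then obtain K where K: "compact K" "K \<subseteq> \<Omega>" "\<And>x. x \<notin> K \<Longrightarrow> \<psi> x = 0" by blast
  then have "closure {x. \<psi> x \<noteq> 0} \<subseteq> K"
    by (intro closure_minimal) (auto intro: compact_imp_closed)
  then show "\<psi> \<in> test_functions \<Omega>"
    using * K compact_closure[of "{x. \<psi> x \<noteq> 0}"] bounded_subset[OF compact_imp_bounded[OF K(1)]]
      closure_subset[of "{x. \<psi> x \<noteq> 0}"]
    unfolding test_functions_def smooth_def by auto
qed

lemma test_functionsI:
  assumes "smooth \<psi>" "compact K" "K \<subseteq> \<Omega>" "\<And>x. x \<notin> K \<Longrightarrow> \<psi> x = 0"
  shows "\<psi> \<in> test_functions \<Omega>"
  using assms unfolding test_functions_iff by blast

lemma test_functionsE: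
  assumes "\<psi> \<in> test_functions \<Omega>"
  obtains K where "compact K" "K \<subseteq> \<Omega>" "\<And>x. x \<notin> K \<Longrightarrow> \<psi> x = 0"
  using assms unfolding test_functions_iff by blast

lemma test_functions_mult:
  assumes "smooth \<eta>" "\<psi> \<in> test_functions \<Omega>"
  shows "(\<lambda>x. \<eta> x * \<psi> x) \<in> test_functions \<Omega>" "(\<lambda>x. \<psi> x * \<eta> x) \<in> test_functions \<Omega>"
  using assms unfolding test_functions_iff by (auto intro!: smooth_mult)

lemma test_functions_iter_partial:
  assumes "\<psi> \<in> test_functions \<Omega>" "set ds \<subseteq> Basis"
  shows "iter_partial ds \<psi> \<in> test_functions \<Omega>"
proof -
  obtain K where K: "compact K" "K \<subseteq> \<Omega>" "\<And>x. x \<notin> K \<Longrightarrow> \<psi> x = 0"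
    using assms test_functionsE by blast
  moreover have "iter_partial ds \<psi> x = 0" if "x \<notin> K" for x
    using K that compact_imp_closed by (intro iter_partial_support[of K]) auto
  moreover have "smooth (iter_partial ds \<psi>)"
    using assms unfolding test_functions_iff by (auto intro: smooth_iter_partial)
  ultimately show ?thesis
    unfolding test_functions_iff by blast
qed

lemma test_functions_mono: "\<psi> \<in> test_functions A \<Longrightarrow> A \<subseteq> B \<Longrightarrow> \<psi> \<in> test_functions B"
  unfolding test_functions_def by auto

section \<open>A smooth bump\<close>

text \<open>The functions \<open>p(1/t) exp(-1/t)\<close>, continued by 0 to the left of the origin. The classical bump
function is built from \<open>p = 1\<close>; a general polynomial makes the family closed under differentiation.\<close>

definition flat_exp :: "real poly \<Rightarrow> real \<Rightarrow> real" where
  "flat_exp p t = (if t > 0 then poly p (1 / t) * exp (- 1 / t) else 0)"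


text \<open>Away from the origin this is the chain rule, since the derivative of \<open>1/t\<close> is the polynomial
\<open>-(1/t)\<^sup>2\<close> in \<open>1/t\<close>. At the origin the exponential decay beats every polynomial.\<close>

lemma flat_exp_DERIV:
  "(flat_exp p has_real_derivative flat_exp (monom 1 2 * (p - pderiv p)) t) (at t)"
proof -
  have decay: "((\<lambda>t. poly p (1 / t) * exp (- 1 / t)) \<longlongrightarrow> 0) (at_right 0)" for p :: "real poly"
  proof -
    have "((\<lambda>s. poly p s * exp (- s)) \<longlongrightarrow> 0) at_top"
    proof -
      have "((\<lambda>s. \<Sum>i\<le>degree p. coeff p i * (s ^ i / exp s)) \<longlongrightarrow> (\<Sum>i\<le>degree p. coeff p i * 0)) at_top"
        by (intro tendsto_sum tendsto_mult tendsto_const tendsto_power_div_exp_0)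
      then show ?thesis
        by (simp add: poly_altdef exp_minus field_simps sum_distrib_left sum_distrib_right sum_divide_distrib)
    qed
    then have "((\<lambda>t. poly p (inverse t) * exp (- inverse t)) \<longlongrightarrow> 0) (at_right 0)"
      by (rule filterlim_compose) (rule filterlim_inverse_at_top_right)
    then show ?thesis by (simp add: field_simps)
  qed
  consider "t > 0" | "t < 0" | "t = 0" by linarith
  then show ?thesis
  proof cases
    case 1
    have "((\<lambda>t. poly p (1 / t) * exp (- 1 / t)) has_real_derivative
        flat_exp (monom 1 2 * (p - pderiv p)) t) (at t)"
      using 1 by (auto intro!: derivative_eq_intros DERIV_chain'[of "\<lambda>t. 1 / t" _ _ _ "poly p"] poly_DERIV
          simp: flat_exp_def poly_monom field_simps power2_eq_square)
    then show ?thesis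
      by (rule has_field_derivative_transform_within[where d = t])
         (use 1 in \<open>auto simp: flat_exp_def dist_real_def\<close>)
  next
    case 2
    have "((\<lambda>t. 0) has_real_derivative flat_exp (monom 1 2 * (p - pderiv p)) t) (at t)"
      using 2 by (simp add: flat_exp_def)
    then show ?thesis
      by (rule has_field_derivative_transform_within[where d = "- t"])
         (use 2 in \<open>auto simp: flat_exp_def dist_real_def\<close>)
  next
    case 3
    have "((\<lambda>h. flat_exp p h / h) \<longlongrightarrow> 0) (at_right 0)"
    proof (rule Lim_transform_eventually[OF decay[of "pCons 0 p"]])
      show "\<forall>\<^sub>F t in at_right 0. poly (pCons 0 p) (1 / t) * exp (- 1 / t) = flat_exp p t / t"
        by (auto simp: flat_exp_def eventually_at_right_field intro!: exI[of _ 1])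
    qed
    moreover have "((\<lambda>h. flat_exp p h / h) \<longlongrightarrow> 0) (at_left 0)"
      by (rule Lim_transform_eventually[OF tendsto_const])
         (auto simp: flat_exp_def eventually_at_left_field intro!: exI[of _ "-1"])
    ultimately have "((\<lambda>h. flat_exp p h / h) \<longlongrightarrow> 0) (at 0)"
      by (simp add: filterlim_split_at)
    then show ?thesis
      using 3 by (simp add: DERIV_def flat_exp_def)
  qed
qed

lemma smooth_flat_exp_ball:
  fixes p :: "real poly"
  shows "smooth (\<lambda>x::'a::euclidean_space. flat_exp p (1 - x \<bullet> x))"
proof -
  have deriv: "((\<lambda>x. flat_exp p (1 - x \<bullet> x)) has_derivative
      (\<lambda>h. flat_exp (monom 1 2 * (p - pderiv p)) (1 - x \<bullet> x) * (- 2 * (h \<bullet> x)))) (at x)"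
    for p and x :: 'a
  proof -
    have "((\<lambda>x::'a. 1 - x \<bullet> x) has_derivative (\<lambda>h. - 2 * (h \<bullet> x))) (at x)"
      by (auto intro!: derivative_eq_intros simp: inner_commute)
    from has_derivative_compose[OF this flat_exp_DERIV[of p "1 - x \<bullet> x", unfolded has_field_derivative_def]]
    show ?thesis .
  qed
  have "C_k k (\<lambda>x::'a. flat_exp p (1 - x \<bullet> x))" for k
  proof (induction k arbitrary: p)
    case 0
    show ?case
      unfolding C_k.simps
      by (intro continuous_at_imp_continuous_on ballI has_derivative_continuous[OF deriv])
  next
    case (Suc k)
    have "partial_deriv b (\<lambda>x::'a. flat_exp p (1 - x \<bullet> x)) =
        (\<lambda>x. flat_exp (monom 1 2 * (p - pderiv p)) (1 - x \<bullet> x) * ((- 2) * (x \<bullet> b)))" for b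
      using partial_deriv_eqI[OF deriv[of p]] by (auto simp: inner_commute)
    moreover have "(\<lambda>x::'a. flat_exp p (1 - x \<bullet> x)) differentiable (at x)" for x
      using deriv[of p] differentiable_def by blast
    moreover have "C_k k (\<lambda>x::'a. flat_exp (monom 1 2 * (p - pderiv p)) (1 - x \<bullet> x) * ((- 2) * (x \<bullet> b)))"
      for b
      by (rule C_k_mult[OF Suc.IH C_k_mult[OF C_k_const C_k_inner]])
    ultimately show ?case
      by (simp only: C_k.simps) blast
  qed
  then show ?thesis by (simp add: smooth_def)
qed

definition bump :: "'a::euclidean_space \<Rightarrow> real" where
  "bump x = flat_exp 1 (1 - x \<bullet> x)"

lemma smooth_bump: "smooth bump"
  using smooth_flat_exp_ball[of 1] by (simp add: bump_def[abs_def])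

lemma bump_nonneg: "bump x \<ge> 0"
  by (simp add: bump_def flat_exp_def)

lemma bump_0_pos: "bump 0 > 0"
  by (simp add: bump_def flat_exp_def)

lemma bump_support: "bump x \<noteq> 0 \<Longrightarrow> norm x < 1"
  by (auto simp: bump_def flat_exp_def norm_eq_sqrt_inner split: if_splits)

lemma bump_uminus: "bump (- x) = bump x"
  by (simp add: bump_def)

section \<open>Mollification\<close>

lemma
  fixes f :: "'a::euclidean_space \<Rightarrow> real"
  assumes f: "f \<in> borel_measurable lebesgue" and c: "c \<noteq> 0"
  shows borel_measurable_lebesgue_affine: "(\<lambda>x. f (a + c *\<^sub>R x)) \<in> borel_measurable lebesgue"
    and integrable_lebesgue_affine_iff:
      "integrable lebesgue (\<lambda>x. f (a + c *\<^sub>R x)) \<longleftrightarrow> integrable lebesgue f"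
    and integral_lebesgue_affine:
      "(LINT x|lebesgue. f x) = \<bar>c\<bar> ^ DIM('a) * (LINT x|lebesgue. f (a + c *\<^sub>R x))"
proof -
  let ?T = "\<lambda>x::'a. a + c *\<^sub>R x"
  have T_eq: "(\<lambda>x::'a. a + (\<Sum>j\<in>Basis. (c * (x \<bullet> j)) *\<^sub>R j)) = ?T"
    unfolding scaleR_scaleR[symmetric] scaleR_sum_right[symmetric] euclidean_representation ..
  have T[measurable]: "?T \<in> lebesgue \<rightarrow>\<^sub>M lebesgue"
    using lebesgue_affine_measurable[where c = "\<lambda>_::'a. c" and t = a] c unfolding T_eq by simp
  have leb: "lebesgue = density (distr lebesgue lebesgue ?T) (\<lambda>_. ennreal (\<bar>c\<bar> ^ DIM('a)))"
    using lebesgue_affine_euclidean[where c = "\<lambda>_::'a. c" and t = a] c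
    unfolding T_eq by (simp add: ennreal_power)
  show meas: "(\<lambda>x. f (?T x)) \<in> borel_measurable lebesgue"
    using measurable_compose[OF T f] .
  have f': "f \<in> borel_measurable (distr lebesgue lebesgue ?T)"
    using f by simp
  have "integrable lebesgue f \<longleftrightarrow>
      integrable (distr lebesgue lebesgue ?T) (\<lambda>x. \<bar>c\<bar> ^ DIM('a) *\<^sub>R f x)"
    by (subst leb, subst integrable_density) (use f' in auto)
  also have "\<dots> \<longleftrightarrow> integrable lebesgue (\<lambda>x. f (?T x))"
    by (subst integrable_distr_eq) (use f c in \<open>auto simp: integrable_mult_left_iff\<close>)
  finally show "integrable lebesgue (\<lambda>x. f (?T x)) \<longleftrightarrow> integrable lebesgue f" ..
  have "(LINT x|lebesgue. f x) = (LINT x|distr lebesgue lebesgue ?T. \<bar>c\<bar> ^ DIM('a) *\<^sub>R f x)"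
    by (subst leb, subst integral_density) (use f' in auto)
  also have "\<dots> = \<bar>c\<bar> ^ DIM('a) * (LINT x|lebesgue. f (?T x))"
    by (subst integral_distr) (use f in auto)
  finally show "(LINT x|lebesgue. f x) = \<bar>c\<bar> ^ DIM('a) * (LINT x|lebesgue. f (?T x))" .
qed

lemma continuous_borel_measurable_lebesgue:
  "continuous_on UNIV f \<Longrightarrow> (f::'a::euclidean_space \<Rightarrow> real) \<in> borel_measurable lebesgue"
  by (rule measurable_completion) (simp add: borel_measurable_continuous_onI)

lemma bounded_if_compact_support:
  fixes f :: "'a::euclidean_space \<Rightarrow> real"
  assumes "continuous_on UNIV f" "compact K" "\<And>x. x \<notin> K \<Longrightarrow> f x = 0"
  obtains B where "B > 0" "\<And>x. \<bar>f x\<bar> \<le> B"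
proof -
  have "compact (f ` K)"
    using assms(1,2) continuous_on_subset compact_continuous_image by blast
  then obtain B where "B > 0" "\<forall>y\<in>f ` K. norm y \<le> B"
    using compact_imp_bounded bounded_pos by blast
  then have "\<bar>f x\<bar> \<le> B" for x
    using assms(3)[of x] by (cases "x \<in> K") auto
  with \<open>B > 0\<close> that show ?thesis by blast
qed

lemma uniformly_continuous_if_bounded_support:
  fixes f :: "'a::euclidean_space \<Rightarrow> 'b::real_normed_vector"
  assumes "continuous_on UNIV f" "\<And>x. x \<notin> cball 0 r \<Longrightarrow> f x = 0"
  shows "uniformly_continuous_on UNIV f"
  unfolding uniformly_continuous_on_def
proof (intro allI impI)
  fix e :: real assume "e > 0"
  have "uniformly_continuous_on (cball 0 (r + 1)) f"
    using assms(1) by (intro compact_uniformly_continuous) (auto intro: continuous_on_subset)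
  then obtain d where d: "d > 0" "\<And>x y. x \<in> cball 0 (r + 1) \<Longrightarrow> y \<in> cball 0 (r + 1) \<Longrightarrow>
      dist y x < d \<Longrightarrow> dist (f y) (f x) < e"
    unfolding uniformly_continuous_on_def using \<open>e > 0\<close> by metis
  have "dist (f y) (f x) < e" if "dist y x < min d 1" for x y
  proof (cases "x \<in> cball 0 r \<or> y \<in> cball 0 r")
    case True
    moreover have "norm x \<le> norm y + norm (y - x)" "norm y \<le> norm x + norm (y - x)"
      by (metis norm_minus_commute norm_triangle_sub)
         (metis norm_triangle_sub)
    ultimately have "x \<in> cball 0 (r + 1)" "y \<in> cball 0 (r + 1)"
      using that by (auto simp: dist_norm)
    then show ?thesis using d(2) that by auto
  next
    case False
    then show ?thesis using assms(2) \<open>e > 0\<close> by auto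
  qed
  then show "\<exists>d>0. \<forall>x\<in>UNIV. \<forall>y\<in>UNIV. dist y x < d \<longrightarrow> dist (f y) (f x) < e"
    using \<open>d > 0\<close> by (intro exI[of _ "min d 1"]) auto
qed

text \<open>The linearization error is controlled by the modulus of continuity of the gradient, which is
uniform because the gradient is continuous with bounded support. Uniformity is what allows the
estimate to be integrated in \<open>conv_has_derivative\<close>.\<close>

lemma smooth_uniform_linearization:
  fixes f :: "'a::euclidean_space \<Rightarrow> real"
  assumes f: "smooth f" and supp: "\<And>x. x \<notin> cball 0 r \<Longrightarrow> f x = 0" and "e > 0"
  shows "\<exists>d>0. \<forall>z h. norm h < d \<longrightarrow>
       \<bar>f (z + h) - f z - (\<Sum>b\<in>Basis. (h \<bullet> b) * partial_deriv b f z)\<bar> \<le> e * norm h"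
proof -
  \<comment> \<open>the gradient, so that the mean value theorem along a segment reads as an inner product\<close>
  define G where "G z = (\<Sum>b\<in>Basis. partial_deriv b f z *\<^sub>R b)" for z
  have inner_G: "h \<bullet> G z = (\<Sum>b\<in>Basis. (h \<bullet> b) * partial_deriv b f z)" for h z
    by (simp add: G_def inner_sum_right mult.commute)
  have "continuous_on UNIV G"
    unfolding G_def
    by (intro continuous_intros smooth_continuous_on smooth_partial_deriv f)
  moreover have "G x = 0" if "x \<notin> cball 0 r" for x
    using partial_deriv_support[of "cball 0 r" f x] supp that by (simp add: G_def)
  ultimately have "uniformly_continuous_on UNIV G"
    by (rule uniformly_continuous_if_bounded_support)
  then obtain d where d: "d > 0" "\<And>x y. dist y x < d \<Longrightarrow> dist (G y) (G x) < e"
    unfolding uniformly_continuous_on_def using \<open>e > 0\<close> by (metis UNIV_I)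
  have "\<bar>f (z + h) - f z - h \<bullet> G z\<bar> \<le> e * norm h" if h: "norm h < d" for z h
  proof -
    have "((\<lambda>t. f (z + t *\<^sub>R h)) has_real_derivative h \<bullet> G (z + t *\<^sub>R h)) (at t)" for t :: real
    proof -
      have "((\<lambda>t. z + t *\<^sub>R h) has_derivative (\<lambda>s. s *\<^sub>R h)) (at t)"
        by (auto intro!: derivative_eq_intros)
      moreover have "(f has_derivative (\<lambda>k. k \<bullet> G (z + t *\<^sub>R h))) (at (z + t *\<^sub>R h))"
        using has_derivative_partial_derivs[OF smooth_differentiable[OF f]] by (simp add: inner_G)
      ultimately have "((\<lambda>t. f (z + t *\<^sub>R h)) has_derivative (\<lambda>s. s *\<^sub>R h \<bullet> G (z + t *\<^sub>R h))) (at t)"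
        by (rule has_derivative_compose)
      then show ?thesis
        by (simp add: has_field_derivative_def mult.commute[of _ "h \<bullet> _"])
    qed
    then obtain t where t: "t > 0" "t < 1" "f (z + 1 *\<^sub>R h) - f (z + 0 *\<^sub>R h) = (1 - 0) * (h \<bullet> G (z + t *\<^sub>R h))"
      using MVT2[of 0 1 "\<lambda>t. f (z + t *\<^sub>R h)" "\<lambda>t. h \<bullet> G (z + t *\<^sub>R h)"] by auto
    have "t * norm h \<le> norm h"
      using t by (simp add: mult_left_le_one_le)
    then have "dist (z + t *\<^sub>R h) z < d"
      using t h by (simp add: dist_norm)
    then have G: "norm (G (z + t *\<^sub>R h) - G z) \<le> e"
      using d(2) by (simp add: dist_norm less_imp_le)
    have "\<bar>f (z + h) - f z - h \<bullet> G z\<bar> = \<bar>h \<bullet> (G (z + t *\<^sub>R h) - G z)\<bar>"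
      using t by (simp add: inner_diff_right)
    also have "\<dots> \<le> norm h * norm (G (z + t *\<^sub>R h) - G z)"
      by (rule Cauchy_Schwarz_ineq2)
    also have "\<dots> \<le> norm h * e"
      using G by (simp add: mult_left_mono)
    finally show ?thesis by (simp add: mult.commute)
  qed
  then show ?thesis
    using d(1) unfolding inner_G by blast
qed

definition locally_integrable :: "('a::euclidean_space \<Rightarrow> real) \<Rightarrow> bool" where
  "locally_integrable w \<longleftrightarrow> w \<in> borel_measurable lebesgue \<and>
     (\<forall>r. integrable lebesgue (\<lambda>y. indicator (cball 0 r) y * w y))"

text \<open>Convolution is only used between a smooth kernel \<open>\<rho>\<close> of bounded support and a function \<open>w\<close> that is
integrable on balls. The integral is taken with respect to the completed measure, so that \<open>w\<close> may be any
Lebesgue measurable function.\<close>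

definition conv :: "('a::euclidean_space \<Rightarrow> real) \<Rightarrow> ('a \<Rightarrow> real) \<Rightarrow> 'a \<Rightarrow> real" where
  "conv \<rho> w x = (LINT y|lebesgue. w y * \<rho> (x - y))"

lemma integrable_conv:
  fixes \<rho> w :: "'a::euclidean_space \<Rightarrow> real"
  assumes w: "locally_integrable w" and \<rho>: "continuous_on UNIV \<rho>"
    and supp: "\<And>x. x \<notin> cball 0 r \<Longrightarrow> \<rho> x = 0"
  shows "integrable lebesgue (\<lambda>y. w y * \<rho> (x - y))"
proof -
  obtain B where B: "B > 0" "\<And>x. \<bar>\<rho> x\<bar> \<le> B"
    using bounded_if_compact_support[OF \<rho> compact_cball supp] by blast
  have "integrable lebesgue (\<lambda>y. B * (indicator (cball 0 (norm x + r)) y * w y))"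
    using w by (simp add: locally_integrable_def)
  then show ?thesis
  proof (rule Bochner_Integration.integrable_bound)
    have "(\<lambda>y. \<rho> (x - y)) \<in> borel_measurable lebesgue"
      using \<rho> by (intro continuous_borel_measurable_lebesgue continuous_intros
          continuous_on_compose2[OF \<rho>]) auto
    then show "(\<lambda>y. w y * \<rho> (x - y)) \<in> borel_measurable lebesgue"
      using w by (auto simp: locally_integrable_def)
    have "norm (w y * \<rho> (x - y)) \<le> norm (B * (indicator (cball 0 (norm x + r)) y * w y))" for y
    proof (cases "norm y \<le> norm x + r")
      case True
      then show ?thesis
        using B(2)[of "x - y"] B(1) by (simp add: abs_mult mult.commute[of B] mult_left_mono)
    next
      case False
      then have "x - y \<notin> cball 0 r"
        using norm_triangle_sub[of y x] by (auto simp: norm_minus_commute)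
      then show ?thesis using supp by simp
    qed
    then show "AE y in lebesgue. norm (w y * \<rho> (x - y)) \<le> norm (B * (indicator (cball 0 (norm x + r)) y * w y))"
      by simp
  qed
qed

text \<open>Differentiation under the integral sign: only the values of \<open>w\<close> in a ball of radius slightly larger
than \<open>r\<close> around \<open>x\<close> matter, and there the linearization error of the kernel is uniformly small.\<close>

lemma conv_has_derivative:
  fixes \<rho> w :: "'a::euclidean_space \<Rightarrow> real"
  assumes w: "locally_integrable w" and \<rho>: "smooth \<rho>"
    and supp: "\<And>x. x \<notin> cball 0 r \<Longrightarrow> \<rho> x = 0"
  shows "(conv \<rho> w has_derivative (\<lambda>h. \<Sum>b\<in>Basis. (h \<bullet> b) * conv (partial_deriv b \<rho>) w x)) (at x)"
  unfolding has_derivative_at_alt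
proof (intro conjI allI impI)
  show "bounded_linear (\<lambda>h. \<Sum>b\<in>Basis. (h \<bullet> b) * conv (partial_deriv b \<rho>) w x)"
    by (intro bounded_linear_sum bounded_linear_mult_const bounded_linear_inner_left)
next
  fix e :: real assume "e > 0"
  define W where "W y = indicator (cball 0 (norm x + r + 1)) y * w y" for y
  define M where "M = (LINT y|lebesgue. \<bar>W y\<bar>)"
  have W: "integrable lebesgue W"
    using w by (simp add: locally_integrable_def W_def[abs_def])
  have M: "M \<ge> 0" by (simp add: M_def)
  have e': "e / (M + 1) > 0" using M \<open>e > 0\<close> by simp
  obtain d0 where d0: "d0 > 0" "\<And>z h. norm h < d0 \<Longrightarrow>
       \<bar>\<rho> (z + h) - \<rho> z - (\<Sum>b\<in>Basis. (h \<bullet> b) * partial_deriv b \<rho> z)\<bar> \<le> e / (M + 1) * norm h"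
    using smooth_uniform_linearization[OF \<rho> supp e'] by blast
  have dsupp: "partial_deriv b \<rho> x = 0" if "x \<notin> cball 0 r" for b x
    using partial_deriv_support[of "cball 0 r" \<rho> x] supp that by simp
  define L where "L h z = \<rho> (z + h) - \<rho> z - (\<Sum>b\<in>Basis. (h \<bullet> b) * partial_deriv b \<rho> z)" for h z
  have "norm (conv \<rho> w y - conv \<rho> w x - (\<Sum>b\<in>Basis. ((y - x) \<bullet> b) * conv (partial_deriv b \<rho>) w x))
      \<le> e * norm (y - x)" if "norm (y - x) < min d0 1" for y
  proof -
    define h where "h = y - x"
    have h: "norm h < d0" "norm h < 1" "y = x + h" using that by (auto simp: h_def)
    have i1: "integrable lebesgue (\<lambda>t. w t * \<rho> (z - t))" for z
      by (rule integrable_conv[OF w smooth_continuous_on[OF \<rho>] supp])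
    have i2: "integrable lebesgue (\<lambda>t. w t * partial_deriv b \<rho> (x - t))" if "b \<in> Basis" for b
      by (rule integrable_conv[OF w smooth_continuous_on[OF smooth_partial_deriv[OF \<rho> that]] dsupp])
    have eq: "(\<lambda>t. w t * L h (x - t)) = (\<lambda>t. w t * \<rho> (y - t) - w t * \<rho> (x - t)
        - (\<Sum>b\<in>Basis. (h \<bullet> b) * (w t * partial_deriv b \<rho> (x - t))))"
      by (simp add: L_def h(3) algebra_simps sum_distrib_left)
    have linearized: "conv \<rho> w y - conv \<rho> w x - (\<Sum>b\<in>Basis. (h \<bullet> b) * conv (partial_deriv b \<rho>) w x)
       = (LINT t|lebesgue. w t * L h (x - t))"
      unfolding eq using i1 i2
      by (simp add: conv_def Bochner_Integration.integral_sum)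
    have "norm (LINT t|lebesgue. w t * L h (x - t)) \<le> (LINT t|lebesgue. e / (M + 1) * norm h * \<bar>W t\<bar>)"
    proof (rule Bochner_Integration.integral_norm_bound_integral)
      show "integrable lebesgue (\<lambda>t. w t * L h (x - t))"
        unfolding eq using i1 i2
        by (intro Bochner_Integration.integrable_diff Bochner_Integration.integrable_sum integrable_mult_right) auto
      show "integrable lebesgue (\<lambda>t. e / (M + 1) * norm h * \<bar>W t\<bar>)"
        using W by simp
      show "norm (w t * L h (x - t)) \<le> e / (M + 1) * norm h * \<bar>W t\<bar>" for t
      proof (cases "norm t \<le> norm x + r + 1")
        case True
        have "\<bar>w t\<bar> * \<bar>L h (x - t)\<bar> \<le> \<bar>w t\<bar> * (e / (M + 1) * norm h)"
          using d0(2)[OF h(1), of "x - t"] by (intro mult_left_mono) (simp_all add: L_def)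
        then show ?thesis using True by (simp add: W_def abs_mult mult_ac)
      next
        case False
        have "norm t \<le> norm x + norm (x - t)" "norm t \<le> norm x + norm (x - t + h) + norm h"
          using norm_triangle_ineq4[of x "x - t"] norm_triangle_ineq4[of "x + h" "x - t + h"]
            norm_triangle_ineq[of x h] by auto
        with False h(2) have "x - t \<notin> cball 0 r" "x - t + h \<notin> cball 0 r" by auto
        then show ?thesis using False supp dsupp by (simp add: L_def W_def)
      qed
    qed
    moreover have "(LINT t|lebesgue. e / (M + 1) * norm h * \<bar>W t\<bar>) = e * norm h * (M / (M + 1))"
      by (simp add: M_def)
    moreover have "e * norm h * (M / (M + 1)) \<le> e * norm h * 1"
      using M \<open>e > 0\<close> by (intro mult_left_mono) auto
    ultimately show ?thesis
      unfolding h_def[symmetric] linearized by linarith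
  qed
  then show "\<exists>d>0. \<forall>y. norm (y - x) < d \<longrightarrow> norm (conv \<rho> w y - conv \<rho> w x -
      (\<Sum>b\<in>Basis. ((y - x) \<bullet> b) * conv (partial_deriv b \<rho>) w x)) \<le> e * norm (y - x)"
    using d0(1) by (intro exI[of _ "min d0 1"]) auto
qed

lemma partial_deriv_conv:
  fixes \<rho> w :: "'a::euclidean_space \<Rightarrow> real"
  assumes "locally_integrable w" "smooth \<rho>" "\<And>x. x \<notin> cball 0 r \<Longrightarrow> \<rho> x = 0" "b \<in> Basis"
  shows "partial_deriv b (conv \<rho> w) = conv (partial_deriv b \<rho>) w"
proof
  fix x
  have "partial_deriv b (conv \<rho> w) x = (\<Sum>c\<in>Basis. (b \<bullet> c) * conv (partial_deriv c \<rho>) w x)"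
    by (rule partial_deriv_eqI[OF conv_has_derivative[OF assms(1-3)]])
  also have "\<dots> = (\<Sum>c\<in>Basis. if c = b then conv (partial_deriv c \<rho>) w x else 0)"
    using assms(4) by (intro sum.cong) (auto simp: inner_Basis)
  finally show "partial_deriv b (conv \<rho> w) x = conv (partial_deriv b \<rho>) w x"
    using assms(4) by simp
qed

lemma smooth_conv:
  fixes \<rho> w :: "'a::euclidean_space \<Rightarrow> real"
  assumes w: "locally_integrable w" and "smooth \<rho>" "\<And>x. x \<notin> cball 0 r \<Longrightarrow> \<rho> x = 0"
  shows "smooth (conv \<rho> w)"
proof (rule smooth_coinduct)
  let ?S = "{conv \<rho> w |\<rho>. smooth \<rho> \<and> (\<forall>x. x \<notin> cball 0 r \<longrightarrow> \<rho> x = 0)}"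
  show "conv \<rho> w \<in> ?S" using assms by blast
  show "f differentiable (at x)" if "f \<in> ?S" for f x
    using that conv_has_derivative[OF w] differentiable_def by blast
  show "partial_deriv b f \<in> ?S" if f: "f \<in> ?S" and b: "b \<in> Basis" for f b
  proof -
    obtain \<sigma> where \<sigma>: "f = conv \<sigma> w" "smooth \<sigma>" "\<And>x. x \<notin> cball 0 r \<Longrightarrow> \<sigma> x = 0"
      using f by blast
    then have "partial_deriv b f = conv (partial_deriv b \<sigma>) w"
      using partial_deriv_conv[OF w \<sigma>(2,3) b] by simp
    moreover have "\<forall>x. x \<notin> cball 0 r \<longrightarrow> partial_deriv b \<sigma> x = 0"
      using partial_deriv_support[of "cball 0 r" \<sigma>] \<sigma>(3) by simp
    ultimately show ?thesis
      using smooth_partial_deriv[OF \<sigma>(2) b] by blast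
  qed
qed

lemma locally_integrable_const: "locally_integrable (\<lambda>x. c)"
  unfolding locally_integrable_def
proof (intro conjI allI)
  fix r :: real
  have "integrable lebesgue (\<lambda>y. indicator (cball (0::'a) r) y *\<^sub>R c)"
    using emeasure_bounded_finite[OF bounded_cball, of "0::'a" r]
    by (intro integrable_indicator) auto
  then show "integrable lebesgue (\<lambda>y. indicator (cball (0::'a) r) y * c)" by simp
qed simp

text \<open>The integral of a compactly supported function does not change under translation, so its
convolution with the constant 1 is a constant function, whose derivative vanishes. Applied to a
product of two functions this is integration by parts.\<close>

lemma integral_partial_deriv_eq_0:
  fixes f :: "'a::euclidean_space \<Rightarrow> real"
  assumes f: "smooth f" and supp: "\<And>x. x \<notin> cball 0 r \<Longrightarrow> f x = 0" and b: "b \<in> Basis"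
  shows "(LINT x|lebesgue. partial_deriv b f x) = 0"
proof -
  have conv_1: "conv g (\<lambda>_. 1) x = (LINT y|lebesgue. g y)" if "smooth g" for g x
    using integral_lebesgue_affine[of g "-1" x] that
    by (simp add: conv_def continuous_borel_measurable_lebesgue smooth_continuous_on)
  have "(LINT x|lebesgue. partial_deriv b f x) = conv (partial_deriv b f) (\<lambda>_. 1) 0"
    by (simp add: conv_1 smooth_partial_deriv f b)
  also have "\<dots> = partial_deriv b (conv f (\<lambda>_. 1)) 0"
    using partial_deriv_conv[OF locally_integrable_const f supp b] by simp
  also have "conv f (\<lambda>_. 1) = (\<lambda>x. LINT y|lebesgue. f y)"
    using conv_1[OF f] by blast
  finally show ?thesis by (simp add: partial_deriv_const)
qed

section \<open>Mollifiers converge in the mean square\<close>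

lemma integral_bump_scaled_pos:
  assumes "c \<noteq> 0"
  shows "(LINT x|lebesgue. bump (c *\<^sub>R x :: 'a::euclidean_space)) > 0"
proof -
  let ?f = "\<lambda>x::'a. bump (c *\<^sub>R x)"
  have smooth: "smooth ?f"
    using smooth_affine[OF smooth_bump, of 0 c] by simp
  have "integrable lebesgue (bump :: 'a \<Rightarrow> real)"
    using integrable_conv[OF locally_integrable_const[of 1] smooth_continuous_on[OF smooth_bump], of 1 0]
      bump_support by (force simp: bump_uminus)
  then have int: "integrable lebesgue ?f"
    using integrable_lebesgue_affine_iff[of "bump :: 'a \<Rightarrow> real" c 0] assms
    by (simp add: continuous_borel_measurable_lebesgue smooth_continuous_on smooth_bump)
  have "(LINT x|lebesgue. ?f x) \<noteq> 0"
  proof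
    assume "(LINT x|lebesgue. ?f x) = 0"
    then have "AE x in lebesgue. ?f x = 0"
      using int by (subst (asm) integral_nonneg_eq_0_iff_AE) (auto simp: bump_nonneg)
    moreover have op: "open {x. ?f x \<noteq> 0}"
      by (intro open_Collect_neq continuous_intros smooth_continuous_on smooth)
    ultimately have "{x. ?f x \<noteq> 0} \<in> null_sets lebesgue"
      by (subst AE_iff_null_sets) auto
    moreover have "0 \<in> {x. ?f x \<noteq> 0}"
      using bump_0_pos[where 'a = 'a] by (simp add: less_imp_neq[symmetric])
    ultimately show False
      using open_not_negligible[OF op] negligible_iff_null_sets by blast
  qed
  moreover have "(LINT x|lebesgue. ?f x) \<ge> 0"
    by (simp add: bump_nonneg)
  ultimately show ?thesis by linarith
qed

text \<open>The normalisation is the integral itself rather than a power of the scale, so that having integral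
1 is immediate.\<close>

definition mollifier :: "nat \<Rightarrow> 'a::euclidean_space \<Rightarrow> real" where
  "mollifier m x = bump (real (Suc m) *\<^sub>R x) / (LINT y|lebesgue. bump (real (Suc m) *\<^sub>R y :: 'a))"

lemma smooth_mollifier: "smooth (mollifier m)"
proof -
  have "smooth (\<lambda>x. 1 / (LINT y|lebesgue. bump (real (Suc m) *\<^sub>R y :: 'a)) * bump (0 + real (Suc m) *\<^sub>R x :: 'a))"
    by (intro smooth_mult smooth_const smooth_affine smooth_bump)
  then show ?thesis by (simp add: mollifier_def[abs_def])
qed

lemma mollifier_nonneg: "mollifier m x \<ge> 0"
  unfolding mollifier_def by (intro divide_nonneg_nonneg bump_nonneg integral_nonneg_AE) (simp add: bump_nonneg)

lemma mollifier_support: "x \<notin> cball 0 (1 / real (Suc m)) \<Longrightarrow> mollifier m x = 0"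
  using bump_support[of "real (Suc m) *\<^sub>R x"] by (auto simp: mollifier_def field_simps simp del: of_nat_Suc)

lemma integral_mollifier: "(LINT x|lebesgue. mollifier m (x::'a::euclidean_space)) = 1"
  using integral_bump_scaled_pos[of "real (Suc m)", where 'a = 'a] by (simp add: mollifier_def)

lemma L2_space_UNIV:
  "f \<in> L2_space UNIV \<longleftrightarrow> f \<in> borel_measurable lebesgue \<and> integrable lebesgue (\<lambda>x. (f x)\<^sup>2)"
  by (simp add: L2_space_def lebesgue_on_UNIV_eq)

lemma integrable_mult_L2:
  assumes "f \<in> L2_space \<Omega>" "g \<in> L2_space \<Omega>"
  shows "integrable (lebesgue_on \<Omega>) (\<lambda>x. f x * g x)"
proof (rule Bochner_Integration.integrable_bound)
  show "integrable (lebesgue_on \<Omega>) (\<lambda>x. (f x)\<^sup>2 + (g x)\<^sup>2)"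
    using assms by (simp add: L2_space_def)
  show "(\<lambda>x. f x * g x) \<in> borel_measurable (lebesgue_on \<Omega>)"
    using assms by (auto simp: L2_space_def)
  have "\<bar>a * b\<bar> \<le> a\<^sup>2 + b\<^sup>2" for a b :: real
  proof -
    have "2 * (\<bar>a\<bar> * \<bar>b\<bar>) \<le> a\<^sup>2 + b\<^sup>2"
      using sum_squares_bound[of "\<bar>a\<bar>" "\<bar>b\<bar>"] by simp
    moreover have "0 \<le> \<bar>a\<bar> * \<bar>b\<bar>" by simp
    ultimately show ?thesis unfolding abs_mult by linarith
  qed
  then show "AE x in lebesgue_on \<Omega>. norm (f x * g x) \<le> norm ((f x)\<^sup>2 + (g x)\<^sup>2)"
    by simp
qed

lemma L2_space_cmult: "f \<in> L2_space \<Omega> \<Longrightarrow> (\<lambda>x. c * f x) \<in> L2_space \<Omega>"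
  by (auto simp: L2_space_def power_mult_distrib)

lemma L2_space_add:
  assumes "f \<in> L2_space \<Omega>" "g \<in> L2_space \<Omega>"
  shows "(\<lambda>x. f x + g x) \<in> L2_space \<Omega>"
  using assms integrable_mult_L2[OF assms] by (auto simp: L2_space_def power2_sum mult.assoc)

lemma L2_space_diff:
  assumes "f \<in> L2_space \<Omega>" "g \<in> L2_space \<Omega>"
  shows "(\<lambda>x. f x - g x) \<in> L2_space \<Omega>"
  using L2_space_add[OF assms(1) L2_space_cmult[OF assms(2), of "-1"]] by simp

lemma L2_space_mult_bounded:
  assumes f: "f \<in> L2_space \<Omega>" and g: "g \<in> borel_measurable (lebesgue_on \<Omega>)" "\<And>x. \<bar>g x\<bar> \<le> B"
  shows "(\<lambda>x. g x * f x) \<in> L2_space \<Omega>"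
proof -
  have "integrable (lebesgue_on \<Omega>) (\<lambda>x. (g x * f x)\<^sup>2)"
  proof (rule Bochner_Integration.integrable_bound)
    show "integrable (lebesgue_on \<Omega>) (\<lambda>x. B\<^sup>2 * (f x)\<^sup>2)"
      using f by (simp add: L2_space_def)
    show "(\<lambda>x. (g x * f x)\<^sup>2) \<in> borel_measurable (lebesgue_on \<Omega>)"
      using f g by (auto simp: L2_space_def)
    have "(g x)\<^sup>2 \<le> B\<^sup>2" for x
      using power_mono[OF g(2)[of x], of 2] by simp
    then show "AE x in lebesgue_on \<Omega>. norm ((g x * f x)\<^sup>2) \<le> norm (B\<^sup>2 * (f x)\<^sup>2)"
      by (auto simp: power_mult_distrib mult_right_mono)
  qed
  then show ?thesis using f g by (auto simp: L2_space_def)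
qed

lemma integrable_indicator_cball:
  "integrable lebesgue (\<lambda>x. indicator (cball (0::'a::euclidean_space) r) x * (c::real))"
  using locally_integrable_const[of c] unfolding locally_integrable_def by blast

lemma L2_space_compact_support:
  fixes f :: "'a::euclidean_space \<Rightarrow> real"
  assumes "continuous_on UNIV f" "\<And>x. x \<notin> cball 0 r \<Longrightarrow> f x = 0"
  shows "f \<in> L2_space UNIV"
proof -
  obtain B where B: "\<And>x. \<bar>f x\<bar> \<le> B"
    using bounded_if_compact_support[OF assms(1) compact_cball assms(2)] by blast
  have meas: "f \<in> borel_measurable lebesgue"
    using assms(1) by (rule continuous_borel_measurable_lebesgue)
  have "integrable lebesgue (\<lambda>x. (f x)\<^sup>2)"
  proof (rule Bochner_Integration.integrable_bound[OF integrable_indicator_cball])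
    show "AE x in lebesgue. norm ((f x)\<^sup>2) \<le> norm (indicator (cball 0 r) x * B\<^sup>2)"
    proof (rule AE_I2)
      fix x
      show "norm ((f x)\<^sup>2) \<le> norm (indicator (cball 0 r) x * B\<^sup>2)"
        using assms(2)[of x] power_mono[OF B[of x], of 2] by (cases "x \<in> cball 0 r") auto
    qed
  qed (use meas in auto)
  with meas show ?thesis by (simp add: L2_space_UNIV)
qed

lemma locally_integrable_L2:
  assumes "f \<in> L2_space UNIV"
  shows "locally_integrable f"
  unfolding locally_integrable_def
proof (intro conjI allI)
  fix r
  have "(\<lambda>y::'a. indicator (cball 0 r) y) \<in> L2_space UNIV"
    using integrable_indicator_cball[of r 1]
    by (auto simp: L2_space_UNIV power2_eq_square indicator_inter_arith[symmetric])
  then show "integrable lebesgue (\<lambda>y. indicator (cball 0 r) y * f y)"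
    using integrable_mult_L2[OF _ assms] by (simp add: lebesgue_on_UNIV_eq)
qed (use assms in \<open>simp add: L2_space_UNIV\<close>)

lemma locally_integrable_integrable:
  assumes "integrable lebesgue f"
  shows "locally_integrable f"
  unfolding locally_integrable_def
  using assms integrable_mult_indicator[OF _ assms] by auto

lemma integral_lebesgue_reflect:
  fixes f :: "'a::euclidean_space \<Rightarrow> real"
  assumes "f \<in> borel_measurable lebesgue"
  shows "(LINT y|lebesgue. f (x - y)) = (LINT y|lebesgue. f y)"
  using integral_lebesgue_affine[OF assms, of "-1" x] by simp

text \<open>Convolution with a probability density does not increase the mean square: pointwise this is
Jensen's inequality, which is then integrated with Tonelli's theorem.\<close>

lemma conv_L2_contraction:
  fixes f \<rho> :: "'a::euclidean_space \<Rightarrow> real"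
  assumes f: "f \<in> L2_space UNIV" and \<rho>: "smooth \<rho>"
    and supp: "\<And>x. x \<notin> cball 0 r \<Longrightarrow> \<rho> x = 0"
    and nonneg: "\<And>x. \<rho> x \<ge> 0" and one: "(LINT x|lebesgue. \<rho> x) = 1"
  shows "conv \<rho> f \<in> L2_space UNIV"
    and "(LINT x|lebesgue. (conv \<rho> f x)\<^sup>2) \<le> (LINT x|lebesgue. (f x)\<^sup>2)"
proof -
  have meas: "conv \<rho> f \<in> borel_measurable lebesgue"
    by (intro continuous_borel_measurable_lebesgue smooth_continuous_on
        smooth_conv[OF locally_integrable_L2[OF f] \<rho> supp])
  have f2: "integrable lebesgue (\<lambda>x. (f x)\<^sup>2)" and fm: "f \<in> borel_measurable lebesgue"
    using f by (simp_all add: L2_space_UNIV)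
  have cont: "continuous_on UNIV \<rho>" by (rule smooth_continuous_on[OF \<rho>])
  have i1: "integrable lebesgue (\<lambda>y. f y * \<rho> (x - y))" for x
    by (rule integrable_conv[OF locally_integrable_L2[OF f] cont supp])
  have i2: "integrable lebesgue (\<lambda>y. (f y)\<^sup>2 * \<rho> (x - y))" for x
    by (rule integrable_conv[OF locally_integrable_integrable[OF f2] cont supp])
  have i0: "integrable lebesgue (\<lambda>y. \<rho> (x - y))" for x
    using integrable_conv[OF locally_integrable_const[of 1] cont supp] by simp
  have one': "(LINT y|lebesgue. \<rho> (x - y)) = 1" for x
    using integral_lebesgue_reflect[OF continuous_borel_measurable_lebesgue[OF cont]] one by simp
  have jensen: "(conv \<rho> f x)\<^sup>2 \<le> (LINT y|lebesgue. (f y)\<^sup>2 * \<rho> (x - y))" for x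
  proof -
    \<comment> \<open>the variance of \<open>f\<close> under the density \<open>\<rho> (x - y)\<close> is nonnegative\<close>
    define a where "a = conv \<rho> f x"
    have "0 \<le> (LINT y|lebesgue. (f y - a)\<^sup>2 * \<rho> (x - y))"
      by (intro integral_nonneg_AE) (simp add: nonneg)
    also have "(\<lambda>y. (f y - a)\<^sup>2 * \<rho> (x - y)) =
        (\<lambda>y. (f y)\<^sup>2 * \<rho> (x - y) - 2 * a * (f y * \<rho> (x - y)) + a\<^sup>2 * \<rho> (x - y))"
      by (auto simp: power2_diff algebra_simps)
    also have "(LINT y|lebesgue. \<dots> y) = (LINT y|lebesgue. (f y)\<^sup>2 * \<rho> (x - y)) - 2 * a * a + a\<^sup>2"
      using i0 i1 i2 by (simp add: one' a_def conv_def)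
    finally show ?thesis by (simp add: a_def power2_eq_square)
  qed
  \<comment> \<open>Tonelli's theorem needs Borel measurability on the product space, hence a Borel representative\<close>
  obtain g where g: "g \<in> borel_measurable lborel" "AE x in lborel. f x = g x"
    using completion_ex_borel_measurable_real[OF fm] by blast
  have g_meas[measurable]: "g \<in> borel_measurable borel" using g(1) by simp
  have \<rho>_meas[measurable]: "\<rho> \<in> borel_measurable borel"
    by (rule borel_measurable_continuous_onI[OF cont])
  have "(\<integral>\<^sup>+x. ennreal ((conv \<rho> f x)\<^sup>2) \<partial>lebesgue)
      \<le> (\<integral>\<^sup>+x. ennreal (LINT y|lebesgue. (f y)\<^sup>2 * \<rho> (x - y)) \<partial>lebesgue)"
    by (intro nn_integral_mono ennreal_leI jensen)
  also have "\<dots> = (\<integral>\<^sup>+x. (\<integral>\<^sup>+y. ennreal ((f y)\<^sup>2 * \<rho> (x - y)) \<partial>lborel) \<partial>lborel)"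
    using i2 by (subst nn_integral_eq_integral[symmetric]) (auto simp: nonneg nn_integral_completion)
  also have "\<dots> = (\<integral>\<^sup>+x. (\<integral>\<^sup>+y. ennreal ((g y)\<^sup>2 * \<rho> (x - y)) \<partial>lborel) \<partial>lborel)"
    using g(2) by (intro nn_integral_cong nn_integral_cong_AE) auto
  also have "\<dots> = (\<integral>\<^sup>+y. (\<integral>\<^sup>+x. ennreal ((g y)\<^sup>2 * \<rho> (x - y)) \<partial>lborel) \<partial>lborel)"
    by (rule lborel_pair.Fubini') measurable
  also have "\<dots> = (\<integral>\<^sup>+y. ennreal ((g y)\<^sup>2) \<partial>lborel)"
  proof (intro nn_integral_cong)
    fix y
    have "integrable lebesgue (\<lambda>x. \<rho> (x - y))" "(LINT x|lebesgue. \<rho> (x - y)) = 1"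
      using integrable_lebesgue_affine_iff[of \<rho> 1 "- y"] integral_lebesgue_affine[of \<rho> 1 "- y"]
        i0[of 0] integrable_lebesgue_affine_iff[of \<rho> "-1" 0] one continuous_borel_measurable_lebesgue[OF cont]
      by simp_all
    then have "(\<integral>\<^sup>+x. ennreal (\<rho> (x - y)) \<partial>lborel) = 1"
      using nn_integral_eq_integral[of lebesgue "\<lambda>x. \<rho> (x - y)"]
      by (simp add: nonneg nn_integral_completion)
    then show "(\<integral>\<^sup>+x. ennreal ((g y)\<^sup>2 * \<rho> (x - y)) \<partial>lborel) = ennreal ((g y)\<^sup>2)"
      by (simp add: ennreal_mult' nonneg nn_integral_cmult)
  qed
  also have "\<dots> = (\<integral>\<^sup>+y. ennreal ((f y)\<^sup>2) \<partial>lebesgue)"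
    using g(2) unfolding nn_integral_completion by (intro nn_integral_cong_AE) auto
  also have "\<dots> = ennreal (LINT y|lebesgue. (f y)\<^sup>2)"
    using f2 by (intro nn_integral_eq_integral) auto
  finally have bound: "(\<integral>\<^sup>+x. ennreal ((conv \<rho> f x)\<^sup>2) \<partial>lebesgue) \<le> ennreal (LINT y|lebesgue. (f y)\<^sup>2)" .
  have int: "integrable lebesgue (\<lambda>x. (conv \<rho> f x)\<^sup>2)"
    using bound meas by (intro integrableI_nonneg) (auto simp: le_less_trans)
  with meas show "conv \<rho> f \<in> L2_space UNIV" by (simp add: L2_space_UNIV)
  show "(LINT x|lebesgue. (conv \<rho> f x)\<^sup>2) \<le> (LINT x|lebesgue. (f x)\<^sup>2)"
    using bound int by (subst (asm) nn_integral_eq_integral) auto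
qed


lemma conv_mollifier_contraction:
  assumes "f \<in> L2_space UNIV"
  shows "conv (mollifier m) f \<in> L2_space UNIV"
    and "(LINT x|lebesgue. (conv (mollifier m) f x)\<^sup>2) \<le> (LINT x|lebesgue. (f x)\<^sup>2)"
  using conv_L2_contraction[OF assms smooth_mollifier mollifier_support mollifier_nonneg integral_mollifier]
  by blast+

text \<open>Truncation in the domain and in the range converges in the mean square, by dominated convergence.\<close>

lemma L2_dense_bounded:
  fixes f :: "'a::euclidean_space \<Rightarrow> real"
  assumes f: "f \<in> L2_space UNIV"
  shows "(\<lambda>k. LINT x|lebesgue. (f x - indicator (cball 0 (real k)) x * max (- real k) (min (real k) (f x)))\<^sup>2)
    \<longlonglongrightarrow> 0"
proof -
  define F where "F k x = indicator (cball 0 (real k)) x * max (- real k) (min (real k) (f x))" for k x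
  have fm[measurable]: "f \<in> borel_measurable lebesgue" and f2: "integrable lebesgue (\<lambda>x. (f x)\<^sup>2)"
    using f by (simp_all add: L2_space_UNIV)
  have "(\<lambda>k. LINT x|lebesgue. (f x - F k x)\<^sup>2) \<longlonglongrightarrow> (LINT x|(lebesgue :: 'a measure). 0)"
  proof (rule integral_dominated_convergence[OF _ _ f2])
    show "AE x in lebesgue. (\<lambda>k. (f x - F k x)\<^sup>2) \<longlonglongrightarrow> 0"
    proof (rule AE_I2)
      fix x
      obtain k0 where k0: "max (norm x) \<bar>f x\<bar> \<le> real k0" using real_arch_simple by blast
      have "\<forall>\<^sub>F k in sequentially. (f x - F k x)\<^sup>2 = 0"
        using eventually_ge_at_top[of k0]
      proof eventually_elim
        case (elim k)
        then have "norm x \<le> real k" "\<bar>f x\<bar> \<le> real k" using k0 by linarith+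
        then show ?case by (auto simp: F_def)
      qed
      then show "(\<lambda>k. (f x - F k x)\<^sup>2) \<longlonglongrightarrow> 0"
        by (rule tendsto_eventually)
    qed
    fix k
    have "\<bar>f x - F k x\<bar> \<le> \<bar>f x\<bar>" for x
      by (auto simp: F_def indicator_def)
    then show "AE x in lebesgue. norm ((f x - F k x)\<^sup>2) \<le> (f x)\<^sup>2"
      by (simp add: abs_le_square_iff)
    show "(\<lambda>x. (f x - F k x)\<^sup>2) \<in> borel_measurable lebesgue"
      unfolding F_def
      by (intro borel_measurable_power borel_measurable_diff fm borel_measurable_times borel_measurable_indicator
          borel_measurable_max borel_measurable_min borel_measurable_const) simp
  qed simp
  then show ?thesis by (simp add: F_def)
qed

text \<open>A measurable function is a limit of continuous functions almost everywhere. Clipping these and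
cutting them off near the boundary of a ball keeps the limit and provides a common bound, so that
the convergence holds in the mean square as well.\<close>

lemma L2_dense_continuous_bounded:
  fixes f :: "'a::euclidean_space \<Rightarrow> real"
  assumes f: "f \<in> borel_measurable lebesgue" and bound: "\<And>x. \<bar>f x\<bar> \<le> k"
    and supp: "\<And>x. x \<notin> cball 0 k \<Longrightarrow> f x = 0" and "e > 0"
  shows "\<exists>h. continuous_on UNIV h \<and> (\<forall>x. x \<notin> cball 0 (k + 1) \<longrightarrow> h x = 0) \<and>
    (LINT x|lebesgue. (f x - h x)\<^sup>2) < e"
proof -
  have k: "k \<ge> 0" using bound[of 0] by linarith
  obtain N g where N: "negligible N" and g: "\<And>n::nat. continuous_on UNIV (g n)"
    and lim: "\<And>x. x \<notin> N \<Longrightarrow> (\<lambda>n. g n x) \<longlonglongrightarrow> f x"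
    using lebesgue_measurable_imp_measurable_on[OF f, of UNIV] unfolding measurable_on_def by auto
  \<comment> \<open>1 on the ball of radius \<open>k\<close> and 0 outside the ball of radius \<open>k + 1\<close>\<close>
  define cut where "cut x = max 0 (min 1 (k + 1 - norm x))" for x :: 'a
  define h where "h n x = cut x * max (- k) (min k (g n x))" for n x
  have h_cont: "continuous_on UNIV (h n)" for n
    unfolding h_def cut_def by (intro continuous_intros g)
  have h_supp: "h n x = 0" if "x \<notin> cball 0 (k + 1)" for n x
    using that by (auto simp: h_def cut_def)
  have h_bound: "\<bar>h n x\<bar> \<le> k" for n x
  proof -
    have "\<bar>cut x\<bar> \<le> 1" "\<bar>max (- k) (min k (g n x))\<bar> \<le> k"
      using k by (auto simp: cut_def)
    then have "\<bar>cut x\<bar> * \<bar>max (- k) (min k (g n x))\<bar> \<le> 1 * k"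
      by (intro mult_mono) auto
    then show ?thesis by (simp add: h_def abs_mult)
  qed
  have "(\<lambda>n. LINT x|lebesgue. (f x - h n x)\<^sup>2) \<longlonglongrightarrow> (LINT x|(lebesgue :: 'a measure). 0)"
  proof (rule integral_dominated_convergence[OF _ _ integrable_indicator_cball])
    have "(\<lambda>n. (f x - h n x)\<^sup>2) \<longlonglongrightarrow> 0" if "x \<notin> N" for x
    proof -
      have "(\<lambda>n. (f x - h n x)\<^sup>2) \<longlonglongrightarrow> (f x - cut x * max (- k) (min k (f x)))\<^sup>2"
        unfolding h_def by (intro tendsto_intros lim that)
      moreover have "cut x * max (- k) (min k (f x)) = f x"
        using bound[of x] supp[of x] by (cases "x \<in> cball 0 k") (auto simp: cut_def)
      ultimately show ?thesis by simp
    qed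
    then show "AE x in lebesgue. (\<lambda>n. (f x - h n x)\<^sup>2) \<longlonglongrightarrow> 0"
      using N by (intro AE_I'[of N]) (auto simp: negligible_iff_null_sets)
    fix n
    have "norm ((f x - h n x)\<^sup>2) \<le> indicator (cball 0 (k + 1)) x * (2 * k)\<^sup>2" for x
    proof (cases "x \<in> cball 0 (k + 1)")
      case True
      have "\<bar>f x - h n x\<bar> \<le> 2 * k" using bound[of x] h_bound[of n x] by linarith
      from power_mono[OF this, of 2] show ?thesis using True by simp
    next
      case False
      then have "f x = 0" "h n x = 0" using supp[of x] h_supp[of x n] by auto
      then show ?thesis using False by simp
    qed
    then show "AE x in lebesgue. norm ((f x - h n x)\<^sup>2) \<le> indicator (cball 0 (k + 1)) x * (2 * k)\<^sup>2"
      by simp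
    show "(\<lambda>x. (f x - h n x)\<^sup>2) \<in> borel_measurable lebesgue"
      using f continuous_borel_measurable_lebesgue[OF h_cont] by auto
  qed simp
  then have "\<forall>\<^sub>F n in sequentially. (LINT x|lebesgue. (f x - h n x)\<^sup>2) < e"
    using \<open>e > 0\<close> by (intro order_tendstoD(2)) auto
  then obtain n where "(LINT x|lebesgue. (f x - h n x)\<^sup>2) < e"
    by (meson eventually_happens trivial_limit_sequentially)
  then show ?thesis using h_cont h_supp by blast
qed

lemma L2_dense_continuous:
  fixes f :: "'a::euclidean_space \<Rightarrow> real"
  assumes f: "f \<in> L2_space UNIV" and "e > 0"
  shows "\<exists>h r. continuous_on UNIV h \<and> (\<forall>x. x \<notin> cball 0 r \<longrightarrow> h x = 0) \<and>
    (LINT x|lebesgue. (f x - h x)\<^sup>2) < e"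
proof -
  have "\<forall>\<^sub>F k in sequentially. (LINT x|lebesgue.
      (f x - indicator (cball 0 (real k)) x * max (- real k) (min (real k) (f x)))\<^sup>2) < e / 4"
    using L2_dense_bounded[OF f] \<open>e > 0\<close> by (intro order_tendstoD(2)) auto
  then obtain k where k: "(LINT x|lebesgue.
      (f x - indicator (cball 0 (real k)) x * max (- real k) (min (real k) (f x)))\<^sup>2) < e / 4"
    by (meson eventually_happens trivial_limit_sequentially)
  define F where "F x = indicator (cball 0 (real k)) x * max (- real k) (min (real k) (f x))" for x
  have F: "F \<in> borel_measurable lebesgue"
    unfolding F_def using f
    by (intro borel_measurable_times borel_measurable_indicator
        borel_measurable_max borel_measurable_min borel_measurable_const) (auto simp: L2_space_UNIV)
  have F_bound: "\<bar>F x\<bar> \<le> real k" "x \<notin> cball 0 (real k) \<Longrightarrow> F x = 0" for x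
    by (auto simp: F_def indicator_def)
  obtain h where h: "continuous_on UNIV h" "\<And>x. x \<notin> cball 0 (real k + 1) \<Longrightarrow> h x = 0"
      "(LINT x|lebesgue. (F x - h x)\<^sup>2) < e / 4"
    using L2_dense_continuous_bounded[OF F F_bound, of "e / 4"] \<open>e > 0\<close> by auto
  have hL2: "h \<in> L2_space UNIV" by (rule L2_space_compact_support[OF h(1,2)])
  have FL2: "F \<in> L2_space UNIV"
  proof -
    have "integrable lebesgue (\<lambda>x. (F x)\<^sup>2)"
    proof (rule Bochner_Integration.integrable_bound)
      show "integrable lebesgue (\<lambda>x. (f x)\<^sup>2)" using f by (simp add: L2_space_UNIV)
      have "\<bar>F x\<bar> \<le> \<bar>f x\<bar>" for x by (auto simp: F_def indicator_def)
      then show "AE x in lebesgue. norm ((F x)\<^sup>2) \<le> norm ((f x)\<^sup>2)"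
        by (simp add: abs_le_square_iff)
    qed (use F in auto)
    then show ?thesis using F by (simp add: L2_space_UNIV)
  qed
  have ints: "integrable lebesgue (\<lambda>x. (f x - F x)\<^sup>2)" "integrable lebesgue (\<lambda>x. (F x - h x)\<^sup>2)"
    "integrable lebesgue (\<lambda>x. (f x - h x)\<^sup>2)"
    using L2_space_diff[OF f FL2] L2_space_diff[OF FL2 hL2] L2_space_diff[OF f hL2]
    by (simp_all add: L2_space_UNIV)
  have "(f x - h x)\<^sup>2 \<le> 2 * (f x - F x)\<^sup>2 + 2 * (F x - h x)\<^sup>2" for x
    using sum_squares_bound[of "f x - F x" "F x - h x"] power2_sum[of "f x - F x" "F x - h x"] by simp
  then have "(LINT x|lebesgue. (f x - h x)\<^sup>2)
      \<le> (LINT x|lebesgue. 2 * (f x - F x)\<^sup>2 + 2 * (F x - h x)\<^sup>2)"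
    using ints by (intro integral_mono) auto
  also have "\<dots> = 2 * (LINT x|lebesgue. (f x - F x)\<^sup>2) + 2 * (LINT x|lebesgue. (F x - h x)\<^sup>2)"
    using ints by simp
  also have "\<dots> < e" using k h(3) by (simp add: F_def)
  finally show ?thesis using h by blast
qed

text \<open>For a uniformly continuous function the mollifications converge uniformly, and everything happens
within a fixed ball.\<close>

lemma conv_mollifier_L2_continuous:
  fixes h :: "'a::euclidean_space \<Rightarrow> real"
  assumes h: "continuous_on UNIV h" and supp: "\<And>x. x \<notin> cball 0 r \<Longrightarrow> h x = 0"
  shows "(\<lambda>m. LINT x|lebesgue. (conv (mollifier m) h x - h x)\<^sup>2) \<longlonglongrightarrow> 0"
proof (rule order_tendstoI)
  fix a :: real assume "a < 0"
  moreover have "0 \<le> (LINT x|lebesgue. (conv (mollifier m) h x - h x)\<^sup>2)" for m by simp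
  ultimately show "\<forall>\<^sub>F m in sequentially. a < (LINT x|lebesgue. (conv (mollifier m) h x - h x)\<^sup>2)"
    by (intro always_eventually allI) (meson less_le_trans)
next
  fix e :: real assume "e > 0"
  have hL2: "h \<in> L2_space UNIV" by (rule L2_space_compact_support[OF h supp])
  define V where "V = (LINT x|lebesgue. indicator (cball (0::'a) (r + 1)) x * (1::real))"
  have V: "V \<ge> 0" by (simp add: V_def)
  \<comment> \<open>a uniform error below \<open>d\<close> on a set of volume \<open>V\<close> gives a squared error below \<open>e\<close>, also if \<open>V = 0\<close>\<close>
  define d where "d = sqrt (e / (2 * (V + 1)))"
  have d: "d > 0" "d\<^sup>2 * V < e"
  proof -
    show "d > 0" using \<open>e > 0\<close> V by (simp add: d_def)
    have "d\<^sup>2 * V = e / 2 * (V / (V + 1))" using V \<open>e > 0\<close> by (simp add: d_def)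
    also have "\<dots> \<le> e / 2 * 1" using V \<open>e > 0\<close> by (intro mult_left_mono) auto
    also have "\<dots> < e" using \<open>e > 0\<close> by simp
    finally show "d\<^sup>2 * V < e" .
  qed
  obtain \<delta> where \<delta>: "\<delta> > 0" "\<And>x y. dist y x < \<delta> \<Longrightarrow> dist (h y) (h x) < d"
    using uniformly_continuous_if_bounded_support[OF h supp] d(1)
    unfolding uniformly_continuous_on_def by (metis UNIV_I)
  obtain m0 where m0: "1 / real (Suc m0) < \<delta>" using nat_approx_posE[OF \<delta>(1)] by blast
  have "(LINT x|lebesgue. (conv (mollifier m) h x - h x)\<^sup>2) < e" if m: "m \<ge> m0" for m
  proof -
    have small: "1 / real (Suc m) < \<delta>"
      using m0 m by (meson le_less_trans frac_le le_numeral_extra(4) of_nat_0_less_iff of_nat_le_iff Suc_le_mono zero_less_Suc zero_le_one)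
    note moll = smooth_continuous_on[OF smooth_mollifier[of m]] mollifier_support[of _ m]
    have i1: "integrable lebesgue (\<lambda>y. h y * mollifier m (x - y))" for x
      by (rule integrable_conv[OF locally_integrable_L2[OF hL2] moll])
    have i0: "integrable lebesgue (\<lambda>y. mollifier m (x - y))" for x :: 'a
      using integrable_conv[OF locally_integrable_const[of 1] moll, where x = x] by simp
    have one: "(LINT y|lebesgue. mollifier m (x - y)) = 1" for x :: 'a
      using integral_lebesgue_reflect[of "mollifier m" x] integral_mollifier[of m, where 'a = 'a]
      by (simp add: continuous_borel_measurable_lebesgue smooth_continuous_on smooth_mollifier)
    have close: "\<bar>conv (mollifier m) h x - h x\<bar> \<le> d" for x
    proof -
      have "conv (mollifier m) h x - h x = (LINT y|lebesgue. (h y - h x) * mollifier m (x - y))"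
        using i1 i0 by (simp add: conv_def left_diff_distrib one)
      also have "norm \<dots> \<le> (LINT y|lebesgue. d * mollifier m (x - y))"
      proof (rule Bochner_Integration.integral_norm_bound_integral)
        show "integrable lebesgue (\<lambda>y. (h y - h x) * mollifier m (x - y))"
          using i1 i0 by (simp add: left_diff_distrib)
        show "integrable lebesgue (\<lambda>y. d * mollifier m (x - y))" using i0 by simp
        fix y
        show "norm ((h y - h x) * mollifier m (x - y)) \<le> d * mollifier m (x - y)"
        proof (cases "x - y \<in> cball 0 (1 / real (Suc m))")
          case True
          then have "dist y x < \<delta>" using small by (simp add: dist_norm norm_minus_commute del: of_nat_Suc)
          then have "\<bar>h y - h x\<bar> \<le> d" using \<delta>(2)[of y x] by (simp add: dist_real_def)
          then show ?thesis by (simp add: abs_mult mollifier_nonneg mult_right_mono)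
        next
          case False
          then show ?thesis using mollifier_support[of "x - y" m] by simp
        qed
      qed
      also have "\<dots> = d" by (simp add: one)
      finally show ?thesis by simp
    qed
    have off: "conv (mollifier m) h x - h x = 0" if x: "x \<notin> cball 0 (r + 1)" for x
    proof -
      have "h y * mollifier m (x - y) = 0" for y
      proof (cases "y \<in> cball 0 r")
        case True
        have "1 / real (Suc m) \<le> 1" by simp
        moreover have "norm x \<le> norm y + norm (x - y)" by (rule norm_triangle_sub)
        ultimately have "x - y \<notin> cball 0 (1 / real (Suc m))"
          using x True unfolding mem_cball_0 by linarith
        then show ?thesis using mollifier_support[of "x - y" m] by simp
      qed (simp add: supp)
      then have "(\<lambda>y. h y * mollifier m (x - y)) = (\<lambda>_. 0)" by blast
      then have "conv (mollifier m) h x = 0" unfolding conv_def by (simp only: Bochner_Integration.integral_zero)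
      then show ?thesis using supp[of x] x by auto
    qed
    have "(LINT x|lebesgue. (conv (mollifier m) h x - h x)\<^sup>2)
        \<le> (LINT x|lebesgue. d\<^sup>2 * (indicator (cball (0::'a) (r + 1)) x * 1))"
    proof (rule integral_mono)
      show "integrable lebesgue (\<lambda>x. (conv (mollifier m) h x - h x)\<^sup>2)"
        using L2_space_diff[OF conv_mollifier_contraction(1)[OF hL2] hL2]
        by (simp add: L2_space_UNIV)
      show "integrable lebesgue (\<lambda>x::'a. d\<^sup>2 * (indicator (cball 0 (r + 1)) x * 1))"
        using integrable_indicator_cball[of "r + 1" 1] by (intro integrable_mult_right)
      fix x
      show "(conv (mollifier m) h x - h x)\<^sup>2 \<le> d\<^sup>2 * (indicator (cball 0 (r + 1)) x * 1)"
        using power_mono[OF close[of x], of 2] off[of x] by (cases "x \<in> cball 0 (r + 1)") auto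
    qed
    also have "\<dots> = d\<^sup>2 * V" unfolding V_def by (rule integral_mult_right_zero)
    also have "\<dots> < e" by (rule d(2))
    finally show ?thesis .
  qed
  then show "\<forall>\<^sub>F m in sequentially. (LINT x|lebesgue. (conv (mollifier m) h x - h x)\<^sup>2) < e"
    unfolding eventually_sequentially by blast
qed

text \<open>The case of continuous functions extends by density, because the mollifications are uniformly
bounded operators.\<close>

lemma conv_mollifier_L2:
  fixes f :: "'a::euclidean_space \<Rightarrow> real"
  assumes f: "f \<in> L2_space UNIV"
  shows "(\<lambda>m. LINT x|lebesgue. (conv (mollifier m) f x - f x)\<^sup>2) \<longlonglongrightarrow> 0"
proof (rule order_tendstoI)
  fix a :: real assume "a < 0"
  moreover have "0 \<le> (LINT x|lebesgue. (conv (mollifier m) f x - f x)\<^sup>2)" for m by simp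
  ultimately show "\<forall>\<^sub>F m in sequentially. a < (LINT x|lebesgue. (conv (mollifier m) f x - f x)\<^sup>2)"
    by (intro always_eventually allI) (meson less_le_trans)
next
  fix e :: real assume "e > 0"
  then obtain h r where h: "continuous_on UNIV h" "\<And>x. x \<notin> cball 0 r \<Longrightarrow> h x = 0"
    and fh: "(LINT x|lebesgue. (f x - h x)\<^sup>2) < e / 12"
    using L2_dense_continuous[OF f, of "e / 12"] by auto
  have hL2: "h \<in> L2_space UNIV" by (rule L2_space_compact_support[OF h])
  have fhL2: "(\<lambda>x. f x - h x) \<in> L2_space UNIV" by (rule L2_space_diff[OF f hL2])
  have "\<forall>\<^sub>F m in sequentially. (LINT x|lebesgue. (conv (mollifier m) h x - h x)\<^sup>2) < e / 12"
    using conv_mollifier_L2_continuous[OF h] \<open>e > 0\<close> by (intro order_tendstoD(2)) auto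
  then show "\<forall>\<^sub>F m in sequentially. (LINT x|lebesgue. (conv (mollifier m) f x - f x)\<^sup>2) < e"
  proof eventually_elim
    case (elim m)
    note moll = smooth_mollifier[of m] mollifier_support[of _ m]
    note contr = conv_mollifier_contraction
    have diff: "conv (mollifier m) (\<lambda>x. f x - h x) x = conv (mollifier m) f x - conv (mollifier m) h x" for x
      using integrable_conv[OF locally_integrable_L2[OF f] smooth_continuous_on[OF moll(1)] moll(2), where x = x]
        integrable_conv[OF locally_integrable_L2[OF hL2] smooth_continuous_on[OF moll(1)] moll(2), where x = x]
      by (simp add: conv_def left_diff_distrib)
    let ?A = "\<lambda>x. conv (mollifier m) f x - conv (mollifier m) h x"
    let ?B = "\<lambda>x. conv (mollifier m) h x - h x"
    have A: "?A \<in> L2_space UNIV" and A_le: "(LINT x|lebesgue. (?A x)\<^sup>2) \<le> (LINT x|lebesgue. (f x - h x)\<^sup>2)"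
      using contr[OF fhL2, of m] unfolding diff[abs_def] by simp_all
    have B: "?B \<in> L2_space UNIV" by (rule L2_space_diff[OF contr(1)[OF hL2] hL2])
    have C: "(\<lambda>x. conv (mollifier m) f x - f x) \<in> L2_space UNIV"
      by (rule L2_space_diff[OF contr(1)[OF f] f])
    have three: "(a + b - c)\<^sup>2 \<le> 3 * a\<^sup>2 + 3 * b\<^sup>2 + 3 * c\<^sup>2" for a b c :: real
    proof -
      have "3 * a\<^sup>2 + 3 * b\<^sup>2 + 3 * c\<^sup>2 - (a + b - c)\<^sup>2 = (a - b)\<^sup>2 + (a + c)\<^sup>2 + (b + c)\<^sup>2"
        by (simp add: power2_eq_square algebra_simps)
      then show ?thesis by (smt (verit) zero_le_power2)
    qed
    have "(LINT x|lebesgue. (conv (mollifier m) f x - f x)\<^sup>2)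
        \<le> (LINT x|lebesgue. 3 * (?A x)\<^sup>2 + 3 * (?B x)\<^sup>2 + 3 * (f x - h x)\<^sup>2)"
    proof (rule integral_mono)
      show "(conv (mollifier m) f x - f x)\<^sup>2 \<le> 3 * (?A x)\<^sup>2 + 3 * (?B x)\<^sup>2 + 3 * (f x - h x)\<^sup>2" for x
        using three[of "?A x" "?B x" "f x - h x"] by simp
    qed (use A B C fhL2 in \<open>auto simp: L2_space_UNIV\<close>)
    also have "\<dots> = 3 * (LINT x|lebesgue. (?A x)\<^sup>2) + 3 * (LINT x|lebesgue. (?B x)\<^sup>2)
        + 3 * (LINT x|lebesgue. (f x - h x)\<^sup>2)"
      using A B fhL2 by (simp add: L2_space_UNIV)
    also have "\<dots> < e" using A_le elim fh \<open>e > 0\<close> by linarith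
    finally show ?case .
  qed
qed

section \<open>Weak derivatives\<close>

lemma integral_lebesgue_on:
  fixes f :: "'a::euclidean_space \<Rightarrow> real"
  assumes "\<Omega> \<in> sets lebesgue"
  shows "(LINT x|lebesgue_on \<Omega>. f x) = (LINT x|lebesgue. indicator \<Omega> x * f x)"
  using assms by (subst integral_restrict_space) auto

lemma integral_lebesgue_on_vanish:
  fixes f :: "'a::euclidean_space \<Rightarrow> real"
  assumes "\<Omega> \<in> sets lebesgue" "\<And>x. x \<notin> \<Omega> \<Longrightarrow> f x = 0"
  shows "(LINT x|lebesgue_on \<Omega>. f x) = (LINT x|lebesgue. f x)"
  unfolding integral_lebesgue_on[OF assms(1)]
  by (intro Bochner_Integration.integral_cong refl) (use assms(2) in \<open>auto simp: indicator_def\<close>)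

lemma L2_space_iff_extended:
  fixes f :: "'a::euclidean_space \<Rightarrow> real"
  assumes "\<Omega> \<in> sets lebesgue"
  shows "f \<in> L2_space \<Omega> \<longleftrightarrow> (\<lambda>x. indicator \<Omega> x * f x) \<in> L2_space UNIV"
proof -
  have sq: "(indicator \<Omega> x * f x)\<^sup>2 = indicator \<Omega> x * (f x)\<^sup>2" for x
    by (auto simp: indicator_def)
  show ?thesis
    using assms borel_measurable_restrict_space_iff[of \<Omega> lebesgue f]
      integrable_restrict_space[of \<Omega> lebesgue "\<lambda>x. (f x)\<^sup>2"]
    unfolding L2_space_UNIV sq by (simp add: L2_space_def)
qed

lemma L2_space_antimono:
  fixes f :: "'a::euclidean_space \<Rightarrow> real"
  assumes "f \<in> L2_space B" "A \<subseteq> B" "A \<in> sets lebesgue" "B \<in> sets lebesgue"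
  shows "f \<in> L2_space A"
proof -
  have "(\<lambda>x. indicator A x * (indicator B x * f x)) \<in> L2_space UNIV"
    by (rule L2_space_mult_bounded[where B = 1])
       (use assms L2_space_iff_extended[of B f] in \<open>auto simp: lebesgue_on_UNIV_eq\<close>)
  also have "(\<lambda>x. indicator A x * (indicator B x * f x)) = (\<lambda>x. indicator A x * f x)"
    using assms(2) by (intro ext) (auto split: split_indicator)
  finally show ?thesis using L2_space_iff_extended assms(3) by blast
qed

lemma L2_space_vanish:
  fixes f :: "'a::euclidean_space \<Rightarrow> real"
  assumes "f \<in> L2_space \<Omega>" "\<Omega> \<in> sets lebesgue" "\<And>x. x \<notin> \<Omega> \<Longrightarrow> f x = 0"
  shows "f \<in> L2_space UNIV"
proof -
  have "(\<lambda>x. indicator \<Omega> x * f x) = f"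
    by (intro ext) (use assms(3) in \<open>auto split: split_indicator\<close>)
  then show ?thesis using L2_space_iff_extended[OF assms(2), of f] assms(1) by simp
qed

lemma test_functions_cball:
  fixes \<psi> :: "'a::euclidean_space \<Rightarrow> real"
  assumes "\<psi> \<in> test_functions \<Omega>"
  obtains r where "\<And>x. x \<notin> cball 0 r \<Longrightarrow> \<psi> x = 0"
proof -
  obtain K where K: "compact K" "\<And>x. x \<notin> K \<Longrightarrow> \<psi> x = 0"
    using test_functionsE[OF assms] by metis
  obtain r where "\<And>x. x \<in> K \<Longrightarrow> norm x \<le> r"
    using compact_imp_bounded[OF K(1)] unfolding bounded_iff by blast
  then show ?thesis using K(2) that[of r] by fastforce
qed

lemma test_functions_smooth: "\<psi> \<in> test_functions \<Omega> \<Longrightarrow> smooth \<psi>"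
  by (simp add: test_functions_iff)

lemma test_functions_L2:
  fixes \<psi> :: "'a::euclidean_space \<Rightarrow> real"
  assumes "\<psi> \<in> test_functions A" "\<Omega> \<in> sets lebesgue"
  shows "\<psi> \<in> L2_space \<Omega>"
proof -
  obtain r where "\<And>x. x \<notin> cball 0 r \<Longrightarrow> \<psi> x = 0"
    using test_functions_cball[OF assms(1)] by blast
  then have "\<psi> \<in> L2_space UNIV"
    by (intro L2_space_compact_support[of _ r] smooth_continuous_on test_functions_smooth[OF assms(1)])
  then show ?thesis by (rule L2_space_antimono) (use assms(2) in auto)
qed

lemma integrable_mult_test:
  fixes u \<psi> :: "'a::euclidean_space \<Rightarrow> real"
  assumes "u \<in> L2_space \<Omega>" "\<psi> \<in> test_functions A" "\<Omega> \<in> sets lebesgue"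
  shows "integrable (lebesgue_on \<Omega>) (\<lambda>x. u x * \<psi> x)"
  by (rule integrable_mult_L2[OF assms(1) test_functions_L2[OF assms(2,3)]])

lemma test_mult_L2:
  fixes u \<eta> :: "'a::euclidean_space \<Rightarrow> real"
  assumes u: "u \<in> L2_space \<Omega>" and \<eta>: "\<eta> \<in> test_functions A" and \<Omega>: "\<Omega> \<in> sets lebesgue"
  shows "(\<lambda>x. \<eta> x * u x) \<in> L2_space \<Omega>"
proof -
  obtain r where "\<And>x. x \<notin> cball 0 r \<Longrightarrow> \<eta> x = 0"
    using test_functions_cball[OF \<eta>] by blast
  then obtain B where "B > 0" "\<And>x. \<bar>\<eta> x\<bar> \<le> B"
    using bounded_if_compact_support[OF smooth_continuous_on[OF test_functions_smooth[OF \<eta>]] compact_cball]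
    by blast
  then show ?thesis
    using test_functions_L2[OF \<eta> \<Omega>] by (intro L2_space_mult_bounded[OF u, of \<eta> B]) (auto simp: L2_space_def)
qed

lemma has_weak_deriv_Nil: "u \<in> L2_space \<Omega> \<Longrightarrow> has_weak_deriv \<Omega> [] u u"
  by (simp add: has_weak_deriv_def)

lemma has_weak_deriv_add:
  fixes u v :: "'a::euclidean_space \<Rightarrow> real"
  assumes "\<Omega> \<in> sets lebesgue" "set ds \<subseteq> Basis" "u \<in> L2_space \<Omega>" "v \<in> L2_space \<Omega>"
    and "has_weak_deriv \<Omega> ds u g" "has_weak_deriv \<Omega> ds v h"
  shows "has_weak_deriv \<Omega> ds (\<lambda>x. u x + v x) (\<lambda>x. g x + h x)"
proof -
  have gh: "g \<in> L2_space \<Omega>" "h \<in> L2_space \<Omega>" using assms(5,6) by (simp_all add: has_weak_deriv_def)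
  have "(LINT x|lebesgue_on \<Omega>. (u x + v x) * iter_partial ds \<psi> x) =
      (-1) ^ length ds * (LINT x|lebesgue_on \<Omega>. (g x + h x) * \<psi> x)" if \<psi>: "\<psi> \<in> test_functions \<Omega>" for \<psi>
  proof -
    have \<psi>': "iter_partial ds \<psi> \<in> test_functions \<Omega>"
      by (rule test_functions_iter_partial[OF \<psi> assms(2)])
    show ?thesis
      using assms(5,6) \<psi> integrable_mult_test[OF assms(3) \<psi>' assms(1)] integrable_mult_test[OF assms(4) \<psi>' assms(1)]
        integrable_mult_test[OF gh(1) \<psi> assms(1)] integrable_mult_test[OF gh(2) \<psi> assms(1)]
      by (simp add: distrib_right has_weak_deriv_def distrib_left)
  qed
  then show ?thesis using gh by (auto simp: has_weak_deriv_def intro: L2_space_add)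
qed

lemma has_weak_deriv_cmult:
  "has_weak_deriv \<Omega> ds u g \<Longrightarrow> has_weak_deriv \<Omega> ds (\<lambda>x. c * u x) (\<lambda>x. c * g x)"
  by (auto simp: has_weak_deriv_def mult.assoc intro: L2_space_cmult)

lemma has_weak_deriv_diff:
  fixes u v :: "'a::euclidean_space \<Rightarrow> real"
  assumes "\<Omega> \<in> sets lebesgue" "set ds \<subseteq> Basis" "u \<in> L2_space \<Omega>" "v \<in> L2_space \<Omega>"
    and "has_weak_deriv \<Omega> ds u g" "has_weak_deriv \<Omega> ds v h"
  shows "has_weak_deriv \<Omega> ds (\<lambda>x. u x - v x) (\<lambda>x. g x - h x)"
  using has_weak_deriv_add[OF assms(1-3) L2_space_cmult[OF assms(4)] assms(5)
      has_weak_deriv_cmult[OF assms(6), of "-1"]] by simp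

text \<open>The derivative of a test function is a test function, so the outermost derivative can be moved to
\<open>u\<close>. Higher weak derivatives can thus be treated one at a time.\<close>

lemma has_weak_deriv_Cons:
  fixes u v :: "'a::euclidean_space \<Rightarrow> real"
  assumes "has_weak_deriv \<Omega> [b] u v" "set ds \<subseteq> Basis"
  shows "has_weak_deriv \<Omega> (b # ds) u g \<longleftrightarrow> has_weak_deriv \<Omega> ds v g"
proof -
  have "(LINT x|lebesgue_on \<Omega>. u x * iter_partial (b # ds) \<psi> x) =
      - (LINT x|lebesgue_on \<Omega>. v x * iter_partial ds \<psi> x)" if "\<psi> \<in> test_functions \<Omega>" for \<psi>
    using assms(1) test_functions_iter_partial[OF that assms(2)] by (simp add: has_weak_deriv_def)
  then show ?thesis
    unfolding has_weak_deriv_def by (auto simp: minus_equation_iff)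
qed

text \<open>The fundamental lemma of the calculus of variations. Testing against \<open>y \<mapsto> \<rho>(x - y)\<close> shows that
the mollifications of such a function vanish at any given distance from the boundary once the scale
is small, and they converge to it in the mean square.\<close>

lemma vanishing_if_orthogonal_to_test_functions:
  fixes g :: "'a::euclidean_space \<Rightarrow> real"
  assumes "open \<Omega>" and g: "g \<in> L2_space \<Omega>"
    and orth: "\<And>\<psi>. \<psi> \<in> test_functions \<Omega> \<Longrightarrow> (LINT x|lebesgue_on \<Omega>. g x * \<psi> x) = 0"
  shows "AE x in lebesgue_on \<Omega>. g x = 0"
proof -
  have \<Omega>: "\<Omega> \<in> sets lebesgue" using assms(1) by simp
  define G where "G x = indicator \<Omega> x * g x" for x
  have G: "G \<in> L2_space UNIV"
    using g L2_space_iff_extended[OF \<Omega>, of g] by (simp add: G_def[abs_def])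
  define F where "F = {U. open U \<and> (AE x in lebesgue. x \<in> U \<longrightarrow> G x = 0)}"
  have local: "\<exists>U\<in>F. p \<in> U" if p: "p \<in> \<Omega>" for p
  proof -
    obtain e where e: "e > 0" "cball p e \<subseteq> \<Omega>"
      using assms(1) p open_contains_cball by blast
    define B where "B = ball p (e / 2)"
    have B: "B \<in> sets lebesgue" by (simp add: B_def)
    obtain m0 where m0: "1 / real (Suc m0) < e / 2" using nat_approx_posE[of "e / 2"] e(1) by auto
    have G2: "integrable lebesgue (\<lambda>x. (G x)\<^sup>2)" using G by (simp add: L2_space_UNIV)
    have BG: "integrable lebesgue (\<lambda>x. indicator B x * (G x)\<^sup>2)"
      using integrable_mult_indicator[OF B G2] by simp
    have "(LINT x|lebesgue. indicator B x * (G x)\<^sup>2) \<le> (LINT x|lebesgue. (conv (mollifier m) G x - G x)\<^sup>2)"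
      if m: "m \<ge> m0" for m
    proof (rule integral_mono[OF BG])
      show "integrable lebesgue (\<lambda>x. (conv (mollifier m) G x - G x)\<^sup>2)"
        using L2_space_diff[OF conv_mollifier_contraction(1)[OF G] G] by (simp add: L2_space_UNIV)
      fix x
      have "1 / real (Suc m) \<le> 1 / real (Suc m0)" using m by (intro divide_left_mono) auto
      then have small: "1 / real (Suc m) < e / 2" using m0 by linarith
      show "indicator B x * (G x)\<^sup>2 \<le> (conv (mollifier m) G x - G x)\<^sup>2"
      proof (cases "x \<in> B")
        case True
        have "cball x (1 / real (Suc m)) \<subseteq> cball p e"
        proof
          fix y assume "y \<in> cball x (1 / real (Suc m))"
          then have "dist p x < e / 2" "dist x y \<le> 1 / real (Suc m)"
            using True by (simp_all only: B_def mem_ball mem_cball)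
          then show "y \<in> cball p e" using small dist_triangle[of p y x] unfolding mem_cball by linarith
        qed
        then have sub: "cball x (1 / real (Suc m)) \<subseteq> \<Omega>" using e(2) by blast
        have "mollifier m (x + (-1) *\<^sub>R y) = 0" if "y \<notin> cball x (1 / real (Suc m))" for y
          using that mollifier_support[of "x - y" m] by (simp add: dist_norm norm_minus_commute)
        then have "(\<lambda>y. mollifier m (x + (-1) *\<^sub>R y)) \<in> test_functions \<Omega>"
          by (intro test_functionsI[OF smooth_affine[OF smooth_mollifier] compact_cball sub])
        from orth[OF this] have "conv (mollifier m) G x = 0"
          unfolding integral_lebesgue_on[OF \<Omega>] by (simp add: conv_def G_def mult.assoc)
        then show ?thesis using True by simp
      qed simp
    qed
    then have "(LINT x|lebesgue. indicator B x * (G x)\<^sup>2) \<le> 0"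
      by (intro tendsto_lowerbound[OF conv_mollifier_L2[OF G]]) (auto simp: eventually_sequentially)
    moreover have "(LINT x|lebesgue. indicator B x * (G x)\<^sup>2) \<ge> 0"
      by simp
    ultimately have "(LINT x|lebesgue. indicator B x * (G x)\<^sup>2) = 0" by linarith
    then have "AE x in lebesgue. indicator B x * (G x)\<^sup>2 = 0"
      using BG by (subst (asm) integral_nonneg_eq_0_iff_AE) auto
    then have "AE x in lebesgue. x \<in> B \<longrightarrow> G x = 0"
      by eventually_elim auto
    then have "B \<in> F" by (simp add: F_def B_def)
    moreover have "p \<in> B" using e(1) by (simp add: B_def)
    ultimately show ?thesis by blast
  qed
  \<comment> \<open>the null sets found locally can be collected because countably many neighbourhoods suffice\<close>
  obtain F' where F': "F' \<subseteq> F" "countable F'" "\<Union>F' = \<Union>F"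
    using Lindelof[of F] by (auto simp: F_def)
  have "AE x in lebesgue. \<forall>U\<in>F'. x \<in> U \<longrightarrow> G x = 0"
    using F' by (subst AE_ball_countable) (auto simp: F_def)
  then have "AE x in lebesgue. x \<in> \<Omega> \<longrightarrow> g x = 0"
  proof eventually_elim
    case (elim x)
    then show ?case using local[of x] F'(3) by (auto simp: G_def)
  qed
  then show ?thesis using \<Omega> by (subst AE_restrict_space_iff) auto
qed

lemma has_weak_deriv_unique:
  fixes u g h :: "'a::euclidean_space \<Rightarrow> real"
  assumes "open \<Omega>" "has_weak_deriv \<Omega> ds u g" "has_weak_deriv \<Omega> ds u h"
  shows "AE x in lebesgue_on \<Omega>. g x = h x"
proof -
  have gh: "g \<in> L2_space \<Omega>" "h \<in> L2_space \<Omega>" using assms by (simp_all add: has_weak_deriv_def)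
  have \<Omega>: "\<Omega> \<in> sets lebesgue" using assms(1) by simp
  have "AE x in lebesgue_on \<Omega>. g x - h x = 0"
  proof (rule vanishing_if_orthogonal_to_test_functions[OF assms(1)])
    fix \<psi> :: "'a \<Rightarrow> real" assume \<psi>: "\<psi> \<in> test_functions \<Omega>"
    have "(LINT x|lebesgue_on \<Omega>. g x * \<psi> x) = (LINT x|lebesgue_on \<Omega>. h x * \<psi> x)"
      using assms(2,3) \<psi> by (auto simp: has_weak_deriv_def)
    then show "(LINT x|lebesgue_on \<Omega>. (g x - h x) * \<psi> x) = 0"
      using integrable_mult_test[OF gh(1) \<psi> \<Omega>] integrable_mult_test[OF gh(2) \<psi> \<Omega>]
      by (simp add: left_diff_distrib)
  qed (intro L2_space_diff gh)
  then show ?thesis by eventually_elim simp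
qed

lemma has_weak_deriv_cong_AE:
  fixes u g h :: "'a::euclidean_space \<Rightarrow> real"
  assumes g: "has_weak_deriv \<Omega> ds u g" and h: "h \<in> borel_measurable (lebesgue_on \<Omega>)"
    and eq: "AE x in lebesgue_on \<Omega>. g x = h x" and \<Omega>: "\<Omega> \<in> sets lebesgue"
  shows "has_weak_deriv \<Omega> ds u h"
proof -
  have gL2: "g \<in> L2_space \<Omega>" using g by (simp add: has_weak_deriv_def)
  have "integrable (lebesgue_on \<Omega>) (\<lambda>x. (h x)\<^sup>2) \<longleftrightarrow> integrable (lebesgue_on \<Omega>) (\<lambda>x. (g x)\<^sup>2)"
    using h gL2 eq by (intro integrable_cong_AE) (auto simp: L2_space_def)
  then have hL2: "h \<in> L2_space \<Omega>" using gL2 h by (simp add: L2_space_def)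
  have "(LINT x|lebesgue_on \<Omega>. g x * \<psi> x) = (LINT x|lebesgue_on \<Omega>. h x * \<psi> x)"
    if "\<psi> \<in> test_functions \<Omega>" for \<psi>
    using integrable_mult_test[OF gL2 that \<Omega>] integrable_mult_test[OF hL2 that \<Omega>] eq
    by (intro integral_cong_AE) auto
  then show ?thesis using g hL2 by (simp add: has_weak_deriv_def)
qed

section \<open>Sobolev spaces\<close>

lemma sobolev_space_L2: "u \<in> sobolev_space k \<Omega> \<Longrightarrow> u \<in> L2_space \<Omega>"
  by (simp add: sobolev_space_def)

lemma sobolev_space_mono: "u \<in> sobolev_space k \<Omega> \<Longrightarrow> j \<le> k \<Longrightarrow> u \<in> sobolev_space j \<Omega>"
  unfolding sobolev_space_def by auto

lemma has_weak_deriv_weak_deriv: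
  assumes "u \<in> sobolev_space k \<Omega>" "set ds \<subseteq> Basis" "length ds \<le> k"
  shows "has_weak_deriv \<Omega> ds u (weak_deriv \<Omega> ds u)"
proof -
  obtain g where "has_weak_deriv \<Omega> ds u g"
    using assms unfolding sobolev_space_def by blast
  then show ?thesis unfolding weak_deriv_def by (rule someI[where P = "has_weak_deriv \<Omega> ds u"])
qed

lemma sobolev_space_0: "sobolev_space 0 \<Omega> = L2_space \<Omega>"
  using has_weak_deriv_Nil by (auto simp: sobolev_space_def)

lemma sobolev_space_Suc:
  fixes u :: "'a::euclidean_space \<Rightarrow> real"
  shows "u \<in> sobolev_space (Suc k) \<Omega> \<longleftrightarrow>
    u \<in> L2_space \<Omega> \<and> (\<forall>b\<in>Basis. \<exists>v\<in>sobolev_space k \<Omega>. has_weak_deriv \<Omega> [b] u v)"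
proof (intro iffI conjI ballI)
  assume u: "u \<in> sobolev_space (Suc k) \<Omega>"
  then show "u \<in> L2_space \<Omega>" by (rule sobolev_space_L2)
  fix b :: 'a assume b: "b \<in> Basis"
  then obtain v where v: "has_weak_deriv \<Omega> [b] u v"
    using has_weak_deriv_weak_deriv[OF u, of "[b]"] by auto
  have "\<exists>g. has_weak_deriv \<Omega> ds v g" if "set ds \<subseteq> Basis" "length ds \<le> k" for ds
    using has_weak_deriv_weak_deriv[OF u, of "b # ds"] that b has_weak_deriv_Cons[OF v that(1)] by auto
  then have "v \<in> sobolev_space k \<Omega>"
    using v by (simp add: sobolev_space_def has_weak_deriv_def)
  with v show "\<exists>v\<in>sobolev_space k \<Omega>. has_weak_deriv \<Omega> [b] u v" by blast
next
  assume u: "u \<in> L2_space \<Omega> \<and> (\<forall>b\<in>Basis. \<exists>v\<in>sobolev_space k \<Omega>. has_weak_deriv \<Omega> [b] u v)"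
  have "\<exists>g. has_weak_deriv \<Omega> ds u g" if ds: "set ds \<subseteq> Basis" "length ds \<le> Suc k" for ds
  proof (cases ds)
    case Nil
    then show ?thesis using u has_weak_deriv_Nil by blast
  next
    case (Cons b ds')
    then obtain v where v: "v \<in> sobolev_space k \<Omega>" "has_weak_deriv \<Omega> [b] u v"
      using u ds(1) by auto
    with Cons that have "has_weak_deriv \<Omega> ds' v (weak_deriv \<Omega> ds' v)"
      by (intro has_weak_deriv_weak_deriv[OF v(1)]) auto
    then show ?thesis using has_weak_deriv_Cons[OF v(2), of ds'] Cons that by auto
  qed
  then show "u \<in> sobolev_space (Suc k) \<Omega>" using u by (simp add: sobolev_space_def)
qed

lemma sobolev_space_add:
  assumes "\<Omega> \<in> sets lebesgue" "u \<in> sobolev_space k \<Omega>" "v \<in> sobolev_space k \<Omega>"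
  shows "(\<lambda>x. u x + v x) \<in> sobolev_space k \<Omega>"
proof -
  have "\<exists>g. has_weak_deriv \<Omega> ds (\<lambda>x. u x + v x) g" if "set ds \<subseteq> Basis" "length ds \<le> k" for ds
    using has_weak_deriv_add[OF assms(1) that(1) assms(2,3)[THEN sobolev_space_L2]
        assms(2,3)[THEN has_weak_deriv_weak_deriv, OF that]] by blast
  then show ?thesis
    using L2_space_add[OF assms(2,3)[THEN sobolev_space_L2]] by (simp add: sobolev_space_def)
qed

lemma sobolev_space_diff:
  assumes "\<Omega> \<in> sets lebesgue" "u \<in> sobolev_space k \<Omega>" "v \<in> sobolev_space k \<Omega>"
  shows "(\<lambda>x. u x - v x) \<in> sobolev_space k \<Omega>"
proof -
  have "\<exists>g. has_weak_deriv \<Omega> ds (\<lambda>x. u x - v x) g" if "set ds \<subseteq> Basis" "length ds \<le> k" for ds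
    using has_weak_deriv_diff[OF assms(1) that(1) assms(2,3)[THEN sobolev_space_L2]
        assms(2,3)[THEN has_weak_deriv_weak_deriv, OF that]] by blast
  then show ?thesis
    using L2_space_diff[OF assms(2,3)[THEN sobolev_space_L2]] by (simp add: sobolev_space_def)
qed

text \<open>The product rule for \<open>\<eta> \<psi>\<close>, with \<open>\<psi>\<close> a test function, is integrated against \<open>u\<close>.\<close>

lemma has_weak_deriv_mult:
  fixes u g \<eta> :: "'a::euclidean_space \<Rightarrow> real"
  assumes \<Omega>: "\<Omega> \<in> sets lebesgue" and b: "b \<in> Basis" and u: "u \<in> L2_space \<Omega>"
    and \<eta>: "\<eta> \<in> test_functions \<Omega>" and g: "has_weak_deriv \<Omega> [b] u g"
  shows "has_weak_deriv \<Omega> [b] (\<lambda>x. \<eta> x * u x) (\<lambda>x. \<eta> x * g x + partial_deriv b \<eta> x * u x)"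
proof -
  have gL2: "g \<in> L2_space \<Omega>" using g by (simp add: has_weak_deriv_def)
  have d\<eta>: "partial_deriv b \<eta> \<in> test_functions \<Omega>"
    using test_functions_iter_partial[OF \<eta>, of "[b]"] b by simp
  have "(LINT x|lebesgue_on \<Omega>. \<eta> x * u x * partial_deriv b \<psi> x) =
      - (LINT x|lebesgue_on \<Omega>. (\<eta> x * g x + partial_deriv b \<eta> x * u x) * \<psi> x)"
    if \<psi>: "\<psi> \<in> test_functions \<Omega>" for \<psi>
  proof -
    have sm: "smooth \<eta>" "smooth \<psi>" using \<eta> \<psi> by (simp_all add: test_functions_smooth)
    have t1: "(\<lambda>x. \<eta> x * \<psi> x) \<in> test_functions \<Omega>" by (rule test_functions_mult(1)[OF sm(1) \<psi>])
    have t2: "(\<lambda>x. partial_deriv b \<eta> x * \<psi> x) \<in> test_functions \<Omega>"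
      by (rule test_functions_mult(1)[OF smooth_partial_deriv[OF sm(1) b] \<psi>])
    have t3: "(\<lambda>x. \<eta> x * partial_deriv b \<psi> x) \<in> test_functions \<Omega>"
      by (rule test_functions_mult(2)[OF smooth_partial_deriv[OF sm(2) b] \<eta>])
    have "(LINT x|lebesgue_on \<Omega>. u x * partial_deriv b (\<lambda>x. \<eta> x * \<psi> x) x) =
        - (LINT x|lebesgue_on \<Omega>. g x * (\<eta> x * \<psi> x))"
      using g t1 by (simp add: has_weak_deriv_def)
    moreover have "u x * partial_deriv b (\<lambda>x. \<eta> x * \<psi> x) x =
        u x * (\<eta> x * partial_deriv b \<psi> x) + u x * (partial_deriv b \<eta> x * \<psi> x)" for x
      by (subst partial_deriv_mult) (auto intro: smooth_differentiable sm simp: algebra_simps)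
    moreover have "(LINT x|lebesgue_on \<Omega>. (\<eta> x * g x + partial_deriv b \<eta> x * u x) * \<psi> x) =
        (LINT x|lebesgue_on \<Omega>. g x * (\<eta> x * \<psi> x) + u x * (partial_deriv b \<eta> x * \<psi> x))"
      by (simp add: algebra_simps)
    moreover have "(LINT x|lebesgue_on \<Omega>. \<eta> x * u x * partial_deriv b \<psi> x) =
        (LINT x|lebesgue_on \<Omega>. u x * (\<eta> x * partial_deriv b \<psi> x))"
      by (simp add: algebra_simps)
    ultimately show ?thesis
      using integrable_mult_test[OF u t3 \<Omega>] integrable_mult_test[OF u t2 \<Omega>] integrable_mult_test[OF gL2 t1 \<Omega>]
      by simp
  qed
  then show ?thesis
    using L2_space_add[OF test_mult_L2[OF gL2 \<eta> \<Omega>] test_mult_L2[OF u d\<eta> \<Omega>]]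
    by (simp add: has_weak_deriv_def)
qed

text \<open>Induction on the order: the weak derivative \<open>\<eta> \<partial>u + (\<partial>\<eta>) u\<close> is a sum of products of the same kind,
of one order less.\<close>

lemma sobolev_space_mult:
  fixes u \<eta> :: "'a::euclidean_space \<Rightarrow> real"
  assumes \<Omega>: "\<Omega> \<in> sets lebesgue"
  shows "u \<in> sobolev_space k \<Omega> \<Longrightarrow> \<eta> \<in> test_functions \<Omega> \<Longrightarrow> (\<lambda>x. \<eta> x * u x) \<in> sobolev_space k \<Omega>"
proof (induction k arbitrary: u \<eta>)
  case 0
  then show ?case using test_mult_L2[OF _ _ \<Omega>] by (simp add: sobolev_space_0)
next
  case (Suc k)
  have u: "u \<in> L2_space \<Omega>" "u \<in> sobolev_space k \<Omega>"
    using Suc.prems(1) by (auto intro: sobolev_space_L2 sobolev_space_mono)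
  show ?case
    unfolding sobolev_space_Suc
  proof (intro conjI ballI)
    show "(\<lambda>x. \<eta> x * u x) \<in> L2_space \<Omega>" by (rule test_mult_L2[OF u(1) Suc.prems(2) \<Omega>])
    fix b :: 'a assume b: "b \<in> Basis"
    then obtain v where v: "v \<in> sobolev_space k \<Omega>" "has_weak_deriv \<Omega> [b] u v"
      using Suc.prems(1) unfolding sobolev_space_Suc by blast
    have "partial_deriv b \<eta> \<in> test_functions \<Omega>"
      using test_functions_iter_partial[OF Suc.prems(2), of "[b]"] b by simp
    then have "(\<lambda>x. \<eta> x * v x + partial_deriv b \<eta> x * u x) \<in> sobolev_space k \<Omega>"
      by (intro sobolev_space_add[OF \<Omega>] Suc.IH v(1) u(2) Suc.prems(2))
    then show "\<exists>v\<in>sobolev_space k \<Omega>. has_weak_deriv \<Omega> [b] (\<lambda>x. \<eta> x * u x) v"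
      using has_weak_deriv_mult[OF \<Omega> b u(1) Suc.prems(2) v(2)] by blast
  qed
qed

section \<open>Approximation by test functions\<close>

text \<open>On the open set \<open>\<Omega> - K\<close> the function is zero, and so is any weak derivative of it, by uniqueness.\<close>

lemma has_weak_deriv_vanish:
  fixes w g :: "'a::euclidean_space \<Rightarrow> real"
  assumes \<Omega>: "open \<Omega>" and K: "closed K" and ds: "set ds \<subseteq> Basis"
    and w: "\<And>x. x \<notin> K \<Longrightarrow> w x = 0" and g: "has_weak_deriv \<Omega> ds w g"
  shows "AE x in lebesgue_on \<Omega>. x \<notin> K \<longrightarrow> g x = 0"
proof -
  have op: "open (\<Omega> - K)" using \<Omega> K by (rule open_Diff)
  have sets: "\<Omega> \<in> sets lebesgue" "\<Omega> - K \<in> sets lebesgue" using \<Omega> op by simp_all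
  have "g \<in> L2_space \<Omega>" using g by (simp add: has_weak_deriv_def)
  then have gL2: "g \<in> L2_space (\<Omega> - K)"
    by (rule L2_space_antimono) (use sets in auto)
  have "AE x in lebesgue_on (\<Omega> - K). g x = 0"
  proof (rule vanishing_if_orthogonal_to_test_functions[OF op gL2])
    fix \<psi> :: "'a \<Rightarrow> real" assume \<psi>: "\<psi> \<in> test_functions (\<Omega> - K)"
    then have \<psi>': "\<psi> \<in> test_functions \<Omega>" by (rule test_functions_mono) auto
    have "iter_partial ds \<psi> \<in> test_functions (\<Omega> - K)"
      by (rule test_functions_iter_partial[OF \<psi> ds])
    then have "w x * iter_partial ds \<psi> x = 0" for x
      using w[of x] by (cases "x \<in> K") (auto elim!: test_functionsE)
    then have "(\<lambda>x. w x * iter_partial ds \<psi> x) = (\<lambda>_. 0)" by blast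
    moreover have "(LINT x|lebesgue_on \<Omega>. w x * iter_partial ds \<psi> x) =
        (-1) ^ length ds * (LINT x|lebesgue_on \<Omega>. g x * \<psi> x)"
      using g \<psi>' by (simp add: has_weak_deriv_def)
    ultimately have "(LINT x|lebesgue_on \<Omega>. g x * \<psi> x) = 0" by simp
    moreover have \<psi>0: "g x * \<psi> x = 0" if "x \<notin> \<Omega> - K" for x
      using that \<psi> by (auto elim!: test_functionsE)
    then have "(LINT x|lebesgue_on \<Omega>. g x * \<psi> x) = (LINT x|lebesgue. g x * \<psi> x)"
      by (intro integral_lebesgue_on_vanish sets) auto
    moreover have "(LINT x|lebesgue_on (\<Omega> - K). g x * \<psi> x) = (LINT x|lebesgue. g x * \<psi> x)"
      by (intro integral_lebesgue_on_vanish sets \<psi>0)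
    ultimately show "(LINT x|lebesgue_on (\<Omega> - K). g x * \<psi> x) = 0" by simp
  qed
  then have "AE x in lebesgue. x \<in> \<Omega> - K \<longrightarrow> g x = 0"
    using sets by (subst (asm) AE_restrict_space_iff) auto
  then have "AE x in lebesgue. x \<in> \<Omega> \<longrightarrow> (x \<notin> K \<longrightarrow> g x = 0)"
    by eventually_elim auto
  then show ?thesis using sets by (subst AE_restrict_space_iff) auto
qed

text \<open>A weak derivative may be altered on a null set, and therefore be chosen to vanish off \<open>K\<close>, where the
function vanishes. Convolutions of both then have their support in the same neighbourhood of \<open>K\<close>.\<close>

lemma has_weak_deriv_localize:
  fixes w g :: "'a::euclidean_space \<Rightarrow> real"
  assumes \<Omega>: "open \<Omega>" and K: "closed K" and ds: "set ds \<subseteq> Basis"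
    and w: "\<And>x. x \<notin> K \<Longrightarrow> w x = 0" and g: "has_weak_deriv \<Omega> ds w g"
  shows "has_weak_deriv \<Omega> ds w (\<lambda>x. indicator K x * g x)"
proof (rule has_weak_deriv_cong_AE[OF g])
  have "K \<in> sets lebesgue" using K by simp
  then have "indicator K \<in> borel_measurable (lebesgue_on \<Omega>)"
    by (intro measurable_restrict_space1 borel_measurable_indicator)
  then show "(\<lambda>x. indicator K x * g x) \<in> borel_measurable (lebesgue_on \<Omega>)"
    using g by (intro borel_measurable_times) (auto simp: has_weak_deriv_def L2_space_def)
  have "AE x in lebesgue_on \<Omega>. x \<notin> K \<longrightarrow> g x = 0"
    by (rule has_weak_deriv_vanish[OF \<Omega> K ds w g])
  then show "AE x in lebesgue_on \<Omega>. g x = indicator K x * g x"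
    by eventually_elim (auto simp: indicator_def)
qed (use \<Omega> in simp)

lemma has_weak_deriv_classical:
  fixes u :: "'a::euclidean_space \<Rightarrow> real"
  assumes u: "smooth u" and supp: "\<And>x. x \<notin> cball 0 r \<Longrightarrow> u x = 0" and b: "b \<in> Basis"
    and \<Omega>: "\<Omega> \<in> sets lebesgue"
  shows "has_weak_deriv \<Omega> [b] u (partial_deriv b u)"
proof -
  have ut: "u \<in> test_functions UNIV"
    by (rule test_functionsI[OF u compact_cball[of 0 r]]) (use supp in auto)
  have dut: "partial_deriv b u \<in> test_functions UNIV"
    using test_functions_iter_partial[OF ut, of "[b]"] b by simp
  have "(LINT x|lebesgue_on \<Omega>. u x * partial_deriv b \<psi> x) = - (LINT x|lebesgue_on \<Omega>. partial_deriv b u x * \<psi> x)"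
    if \<psi>: "\<psi> \<in> test_functions \<Omega>" for \<psi>
  proof -
    have sm: "smooth \<psi>" by (rule test_functions_smooth[OF \<psi>])
    have d\<psi>: "partial_deriv b \<psi> \<in> test_functions \<Omega>"
      using test_functions_iter_partial[OF \<psi>, of "[b]"] b by simp
    have off: "\<psi> x = 0" "partial_deriv b \<psi> x = 0" if "x \<notin> \<Omega>" for x
      using that \<psi> d\<psi> by (auto elim!: test_functionsE)
    have int: "integrable lebesgue (\<lambda>x. u x * partial_deriv b \<psi> x)" "integrable lebesgue (\<lambda>x. \<psi> x * partial_deriv b u x)"
      using integrable_mult_test[OF test_functions_L2[OF ut] d\<psi>, of UNIV]
        integrable_mult_test[OF test_functions_L2[OF \<psi>] dut, of UNIV] by (simp_all add: lebesgue_on_UNIV_eq)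
    have "0 = (LINT x|lebesgue. partial_deriv b (\<lambda>x. u x * \<psi> x) x)"
      by (rule integral_partial_deriv_eq_0[symmetric, of _ r]) (use smooth_mult[OF u sm] supp b in auto)
    also have "\<dots> = (LINT x|lebesgue. u x * partial_deriv b \<psi> x + \<psi> x * partial_deriv b u x)"
      by (intro Bochner_Integration.integral_cong refl partial_deriv_mult smooth_differentiable u sm)
    also have "\<dots> = (LINT x|lebesgue. u x * partial_deriv b \<psi> x) + (LINT x|lebesgue. \<psi> x * partial_deriv b u x)"
      by (rule Bochner_Integration.integral_add[OF int])
    finally show ?thesis
      using off by (simp add: integral_lebesgue_on_vanish[OF \<Omega>] mult.commute)
  qed
  then show ?thesis
    using test_functions_L2[OF dut \<Omega>] by (simp add: has_weak_deriv_def)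
qed

lemma integrable_conv_mollifier:
  fixes f :: "'a::euclidean_space \<Rightarrow> real"
  assumes "f \<in> L2_space UNIV"
  shows "integrable lebesgue (\<lambda>y. f y * mollifier m (x - y))"
  by (rule integrable_conv[OF locally_integrable_L2[OF assms] smooth_continuous_on[OF smooth_mollifier] mollifier_support])

lemma conv_support:
  assumes w: "\<And>x. x \<notin> K \<Longrightarrow> w x = 0" and supp: "\<And>x. x \<notin> cball 0 \<delta> \<Longrightarrow> \<rho> x = 0"
    and x: "\<And>y. y \<in> K \<Longrightarrow> dist x y > \<delta>"
  shows "conv \<rho> w x = 0"
proof -
  have "w y * \<rho> (x - y) = 0" for y
  proof (cases "y \<in> K")
    case True
    then have "x - y \<notin> cball 0 \<delta>" using x[OF True] by (simp add: dist_norm norm_minus_commute)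
    then show ?thesis using supp by simp
  qed (simp add: w)
  then have "(\<lambda>y. w y * \<rho> (x - y)) = (\<lambda>_. 0)" by blast
  then show ?thesis unfolding conv_def by (simp only: Bochner_Integration.integral_zero)
qed

lemma conv_mollifier_test_function:
  fixes w :: "'a::euclidean_space \<Rightarrow> real"
  assumes K: "compact K" and w: "w \<in> L2_space UNIV" "\<And>x. x \<notin> K \<Longrightarrow> w x = 0"
    and sub: "\<And>x. x \<in> K \<Longrightarrow> cball x (1 / real (Suc m)) \<subseteq> \<Omega>"
  shows "conv (mollifier m) w \<in> test_functions \<Omega>"
proof (rule test_functionsI)
  let ?K = "{x + y |x y. x \<in> K \<and> y \<in> cball 0 (1 / real (Suc m))}"
  show "smooth (conv (mollifier m) w)"
    by (rule smooth_conv[OF locally_integrable_L2[OF w(1)] smooth_mollifier mollifier_support])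
  show "compact ?K" by (rule compact_sums[OF K compact_cball])
  show "?K \<subseteq> \<Omega>"
  proof
    fix z assume "z \<in> ?K"
    then obtain x y where "z = x + y" "x \<in> K" "y \<in> cball 0 (1 / real (Suc m))" by blast
    then have "x \<in> K" "z \<in> cball x (1 / real (Suc m))" by (simp_all add: dist_norm del: of_nat_Suc)
    then show "z \<in> \<Omega>" using sub by blast
  qed
  fix x assume x: "x \<notin> ?K"
  show "conv (mollifier m) w x = 0"
  proof (rule conv_support[OF w(2) mollifier_support])
    fix y assume "y \<in> K"
    moreover have "x = y + (x - y)" by simp
    ultimately have "x - y \<notin> cball 0 (1 / real (Suc m))" using x by blast
    then show "dist x y > 1 / real (Suc m)" by (simp add: dist_norm norm_minus_commute del: of_nat_Suc)
  qed
qed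

text \<open>The classical derivative of the convolution at \<open>x\<close> is an integral of \<open>w\<close> against a derivative of
\<open>y \<mapsto> \<rho>(x - y)\<close>. If \<open>x\<close> is close to \<open>K\<close>, this is a test function on \<open>\<Omega>\<close> and the derivative can be
moved to \<open>w\<close>; the factor 2 in the assumption on \<open>K\<close> leaves room for that. If \<open>x\<close> is far from \<open>K\<close>,
both sides vanish.\<close>

lemma has_weak_deriv_conv1:
  fixes w g :: "'a::euclidean_space \<Rightarrow> real"
  assumes \<Omega>: "open \<Omega>" and K: "compact K"
    and sub: "\<And>x. x \<in> K \<Longrightarrow> cball x (2 / real (Suc m)) \<subseteq> \<Omega>"
    and w: "w \<in> L2_space UNIV" "\<And>x. x \<notin> K \<Longrightarrow> w x = 0"
    and g: "g \<in> L2_space UNIV" "\<And>x. x \<notin> K \<Longrightarrow> g x = 0"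
    and b: "b \<in> Basis" and hwd: "has_weak_deriv \<Omega> [b] w g"
  shows "has_weak_deriv \<Omega> [b] (conv (mollifier m) w) (conv (mollifier m) g)"
proof -
  let ?\<delta> = "1 / real (Suc m)"
  let ?\<rho> = "mollifier m :: 'a \<Rightarrow> real"
  have sets: "\<Omega> \<in> sets lebesgue" using \<Omega> by simp
  have K\<Omega>: "K \<subseteq> \<Omega>"
  proof
    fix x assume "x \<in> K"
    then show "x \<in> \<Omega>" using sub[of x] by (auto simp del: of_nat_Suc)
  qed
  have "cball x ?\<delta> \<subseteq> cball x (2 / real (Suc m))" for x :: 'a
    by (intro subset_cball divide_right_mono) auto
  then have "cball x ?\<delta> \<subseteq> \<Omega>" if "x \<in> K" for x
    using sub[OF that] by (rule subset_trans)
  then have "conv ?\<rho> w \<in> test_functions \<Omega>"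
    by (intro conv_mollifier_test_function[OF K w])
  then obtain r where r: "\<And>x. x \<notin> cball 0 r \<Longrightarrow> conv ?\<rho> w x = 0"
    by (rule test_functions_cball) blast
  have smooth: "smooth (conv ?\<rho> w)"
    by (rule smooth_conv[OF locally_integrable_L2[OF w(1)] smooth_mollifier mollifier_support])
  have "partial_deriv b (conv ?\<rho> w) x = conv ?\<rho> g x" for x
  proof -
    have d\<rho>: "partial_deriv b ?\<rho> x = 0" if "x \<notin> cball 0 ?\<delta>" for x
      by (rule partial_deriv_support[OF closed_cball mollifier_support that])
    have eq: "partial_deriv b (conv ?\<rho> w) x = conv (partial_deriv b ?\<rho>) w x"
      by (rule fun_cong[OF partial_deriv_conv[OF locally_integrable_L2[OF w(1)] smooth_mollifier mollifier_support b]])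
    show ?thesis
    proof (cases "\<exists>y\<in>K. dist x y \<le> ?\<delta>")
      case True
      then obtain y0 where y0: "y0 \<in> K" "dist x y0 \<le> ?\<delta>" by blast
      have "cball x ?\<delta> \<subseteq> cball y0 (2 / real (Suc m))"
      proof
        fix z assume "z \<in> cball x ?\<delta>"
        then have "dist x z \<le> ?\<delta>" by (simp only: mem_cball)
        then have "dist y0 z \<le> ?\<delta> + ?\<delta>" using y0(2) dist_triangle[of y0 z x] dist_commute[of x y0] by linarith
        then show "z \<in> cball y0 (2 / real (Suc m))" by simp
      qed
      then have sub': "cball x ?\<delta> \<subseteq> \<Omega>" using sub[OF y0(1)] by blast
      have "?\<rho> (x + (-1) *\<^sub>R y) = 0" if "y \<notin> cball x ?\<delta>" for y
        using that mollifier_support[of "x - y" m] by (simp add: dist_norm norm_minus_commute)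
      then have t: "(\<lambda>y. ?\<rho> (x + (-1) *\<^sub>R y)) \<in> test_functions \<Omega>"
        by (intro test_functionsI[OF smooth_affine[OF smooth_mollifier] compact_cball sub'])
      have "iter_partial [b] (\<lambda>y. ?\<rho> (x + (-1) *\<^sub>R y)) = (\<lambda>y. - partial_deriv b ?\<rho> (x - y))"
        using iter_partial_affine[OF smooth_mollifier, of "[b]" m x "-1"] b by simp
      then have "(LINT y|lebesgue_on \<Omega>. w y * - partial_deriv b ?\<rho> (x - y)) =
          - (LINT y|lebesgue_on \<Omega>. g y * ?\<rho> (x - y))"
        using hwd t unfolding has_weak_deriv_def by auto
      moreover have "w y = 0" "g y = 0" if "y \<notin> \<Omega>" for y
        using that K\<Omega> w(2) g(2) by auto
      ultimately show ?thesis
        unfolding eq by (simp add: integral_lebesgue_on_vanish[OF sets] conv_def)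
    next
      case False
      then have far: "dist x y > ?\<delta>" if "y \<in> K" for y using that by (meson not_le)
      show ?thesis
        unfolding eq
        using conv_support[OF w(2) d\<rho> far] conv_support[OF g(2) mollifier_support far] by simp
    qed
  qed
  then have "partial_deriv b (conv ?\<rho> w) = conv ?\<rho> g" by blast
  then show ?thesis
    using has_weak_deriv_classical[OF smooth r b sets] by simp
qed

text \<open>Iteration of \<open>has_weak_deriv_conv1\<close>. The intermediate weak derivatives have to be localized to \<open>K\<close>
before the next step.\<close>

lemma has_weak_deriv_conv:
  fixes w g :: "'a::euclidean_space \<Rightarrow> real"
  assumes \<Omega>: "open \<Omega>" and K: "compact K"
    and sub: "\<And>x. x \<in> K \<Longrightarrow> cball x (2 / real (Suc m)) \<subseteq> \<Omega>"
    and ds: "set ds \<subseteq> Basis"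
    and w: "w \<in> sobolev_space (length ds) \<Omega>" "\<And>x. x \<notin> K \<Longrightarrow> w x = 0"
    and g: "\<And>x. x \<notin> K \<Longrightarrow> g x = 0" and hwd: "has_weak_deriv \<Omega> ds w g"
  shows "has_weak_deriv \<Omega> ds (conv (mollifier m) w) (conv (mollifier m) g)"
  using ds w g hwd
proof (induction ds arbitrary: w)
  have sets: "\<Omega> \<in> sets lebesgue" using \<Omega> by simp
  have K\<Omega>: "K \<subseteq> \<Omega>"
  proof
    fix x assume "x \<in> K"
    then show "x \<in> \<Omega>" using sub[of x] by (auto simp del: of_nat_Suc)
  qed
  have L2: "f \<in> L2_space UNIV" if "f \<in> L2_space \<Omega>" "\<And>x. x \<notin> K \<Longrightarrow> f x = 0" for f
    by (rule L2_space_vanish[OF that(1) sets]) (use that(2) K\<Omega> in auto)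
  have gL2: "g \<in> L2_space UNIV"
    using hwd g by (intro L2) (auto simp: has_weak_deriv_def)
  {
    case Nil
    have wL2: "w \<in> L2_space \<Omega>" using Nil(2) by (rule sobolev_space_L2)
    have "AE x in lebesgue_on \<Omega>. w x = g x"
      by (rule has_weak_deriv_unique[OF \<Omega> has_weak_deriv_Nil[OF wL2] Nil(5)])
    then have "AE x in lebesgue. x \<in> \<Omega> \<longrightarrow> w x = g x"
      using sets by (subst (asm) AE_restrict_space_iff) auto
    then have "AE x in lebesgue. w x = g x"
      by eventually_elim (use Nil K\<Omega> in \<open>metis subsetD\<close>)
    moreover note integrable_conv_mollifier[OF L2[OF wL2 Nil(3)]] integrable_conv_mollifier[OF gL2]
    ultimately have "conv (mollifier m) w x = conv (mollifier m) g x" for x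
      unfolding conv_def by (intro integral_cong_AE) auto
    then have "conv (mollifier m) w = conv (mollifier m) g" by blast
    moreover have "conv (mollifier m) g \<in> L2_space \<Omega>"
      by (rule L2_space_antimono[OF conv_mollifier_contraction(1)[OF gL2]]) (use sets in auto)
    ultimately show ?case by (simp add: has_weak_deriv_Nil)
  next
    case (Cons b ds)
    then have b: "b \<in> Basis" and ds: "set ds \<subseteq> Basis" by auto
    obtain v0 where v0: "v0 \<in> sobolev_space (length ds) \<Omega>" "has_weak_deriv \<Omega> [b] w v0"
      using Cons.prems(2) b unfolding list.size add_0_right add_Suc_right sobolev_space_Suc by auto
    define v where "v x = indicator K x * v0 x" for x
    have v: "has_weak_deriv \<Omega> [b] w v"
      unfolding v_def by (rule has_weak_deriv_localize[OF \<Omega> compact_imp_closed[OF K] _ Cons.prems(3) v0(2)]) (use b in auto)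
    have v_off: "v x = 0" if "x \<notin> K" for x using that by (simp add: v_def)
    have vg: "has_weak_deriv \<Omega> ds v g"
      using Cons.prems(5) has_weak_deriv_Cons[OF v ds] by blast
    have "\<exists>h. has_weak_deriv \<Omega> ds' v h" if "set ds' \<subseteq> Basis" "length ds' \<le> length ds" for ds'
      using has_weak_deriv_weak_deriv[OF Cons.prems(2), of "b # ds'"] that b has_weak_deriv_Cons[OF v that(1)]
      by auto
    then have "v \<in> sobolev_space (length ds) \<Omega>"
      using v by (simp add: sobolev_space_def has_weak_deriv_def)
    then have "has_weak_deriv \<Omega> ds (conv (mollifier m) v) (conv (mollifier m) g)"
      by (rule Cons.IH[OF ds _ v_off Cons.prems(4) vg])
    moreover have "has_weak_deriv \<Omega> [b] (conv (mollifier m) w) (conv (mollifier m) v)"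
      using v
      by (intro has_weak_deriv_conv1[OF \<Omega> K sub _ Cons.prems(3) _ v_off b v] L2 sobolev_space_L2[OF Cons.prems(2)]
          Cons.prems(3) v_off) (auto simp: has_weak_deriv_def)
    ultimately show ?case using has_weak_deriv_Cons[OF _ ds] by blast
  }
qed


text \<open>Multiplication by a test function gives support in a compact subset of \<open>\<Omega>\<close>, where mollifications of
small scale are test functions and approximate all weak derivatives in the mean square.\<close>

theorem mult_test_function_sobolev_space0:
  fixes u \<eta> :: "'a::euclidean_space \<Rightarrow> real"
  assumes \<Omega>: "open \<Omega>" and u: "u \<in> sobolev_space k \<Omega>" and \<eta>: "\<eta> \<in> test_functions \<Omega>"
  shows "(\<lambda>x. \<eta> x * u x) \<in> sobolev_space0 k \<Omega>"
proof -
  have sets: "\<Omega> \<in> sets lebesgue" using \<Omega> by simp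
  define w where "w x = \<eta> x * u x" for x
  have w: "w \<in> sobolev_space k \<Omega>"
    unfolding w_def by (rule sobolev_space_mult[OF sets u \<eta>])
  obtain K where K: "compact K" "K \<subseteq> \<Omega>" "\<And>x. x \<notin> K \<Longrightarrow> \<eta> x = 0"
    using \<eta> by (rule test_functionsE) blast
  have w_off: "w x = 0" if "x \<notin> K" for x using K(3)[OF that] by (simp add: w_def)
  have L2: "f \<in> L2_space UNIV" if "f \<in> L2_space \<Omega>" "\<And>x. x \<notin> K \<Longrightarrow> f x = 0" for f
    by (rule L2_space_vanish[OF that(1) sets]) (use that(2) K(2) in auto)
  have wL2: "w \<in> L2_space UNIV" by (rule L2[OF sobolev_space_L2[OF w] w_off])
  obtain e where e: "e > 0" "(\<Union>x\<in>K. cball x e) \<subseteq> \<Omega>"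
    using compact_subset_open_imp_cball_epsilon_subset[OF K(1) \<Omega> K(2)] by blast
  obtain m0 where m0: "1 / real (Suc m0) < e / 2" using nat_approx_posE[of "e / 2"] e(1) by auto
  \<comment> \<open>the index is shifted so that all mollifications stay inside \<open>\<Omega>\<close>\<close>
  define \<psi> where "\<psi> m = conv (mollifier (m + m0)) w" for m
  have sub: "cball x (2 / real (Suc (m + m0))) \<subseteq> \<Omega>" if "x \<in> K" for x m
  proof -
    have "1 / real (Suc (m + m0)) \<le> 1 / real (Suc m0)" by (intro divide_left_mono) auto
    with m0 have "2 / real (Suc (m + m0)) \<le> e" by simp
    then have "cball x (2 / real (Suc (m + m0))) \<subseteq> cball x e" by (rule subset_cball)
    then show ?thesis using e(2) that by blast
  qed
  have sub1: "cball x (1 / real (Suc (m + m0))) \<subseteq> \<Omega>" if "x \<in> K" for x m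
  proof -
    have "cball x (1 / real (Suc (m + m0))) \<subseteq> cball x (2 / real (Suc (m + m0)))"
      by (intro subset_cball divide_right_mono) auto
    then show ?thesis using sub[OF that] by (rule subset_trans)
  qed
  have \<psi>: "\<psi> m \<in> test_functions \<Omega>" for m
    unfolding \<psi>_def by (rule conv_mollifier_test_function[OF K(1) wL2 w_off sub1])
  have \<psi>L2: "\<psi> m \<in> L2_space \<Omega>" for m by (rule test_functions_L2[OF \<psi> sets])
  have lim: "(\<lambda>m. LINT x|lebesgue_on \<Omega>. (weak_deriv \<Omega> ds (\<lambda>x. w x - \<psi> m x) x)\<^sup>2) \<longlonglongrightarrow> 0"
    if ds: "set ds \<subseteq> Basis" "length ds \<le> k" for ds
  proof -
    define g where "g x = indicator K x * weak_deriv \<Omega> ds w x" for x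
    have g: "has_weak_deriv \<Omega> ds w g"
      unfolding g_def
      by (rule has_weak_deriv_localize[OF \<Omega> compact_imp_closed[OF K(1)] ds(1) w_off has_weak_deriv_weak_deriv[OF w ds]])
    have g_off: "g x = 0" if "x \<notin> K" for x using that by (simp add: g_def)
    have gL2: "g \<in> L2_space UNIV" using g g_off by (intro L2) (auto simp: has_weak_deriv_def)
    let ?c = "\<lambda>m. conv (mollifier (m + m0)) g"
    have bound: "(LINT x|lebesgue_on \<Omega>. (weak_deriv \<Omega> ds (\<lambda>x. w x - \<psi> m x) x)\<^sup>2)
        \<le> (LINT x|lebesgue. (?c m x - g x)\<^sup>2)" for m
    proof -
      have "has_weak_deriv \<Omega> ds (\<psi> m) (?c m)"
        unfolding \<psi>_def
        by (rule has_weak_deriv_conv[OF \<Omega> K(1) sub ds(1) sobolev_space_mono[OF w ds(2)] w_off g_off g])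
      then have d: "has_weak_deriv \<Omega> ds (\<lambda>x. w x - \<psi> m x) (\<lambda>x. g x - ?c m x)"
        by (rule has_weak_deriv_diff[OF sets ds(1) sobolev_space_L2[OF w] \<psi>L2 g])
      then have wd: "has_weak_deriv \<Omega> ds (\<lambda>x. w x - \<psi> m x) (weak_deriv \<Omega> ds (\<lambda>x. w x - \<psi> m x))"
        unfolding weak_deriv_def by (rule someI[where P = "has_weak_deriv \<Omega> ds (\<lambda>x. w x - \<psi> m x)"])
      have cL2: "(\<lambda>x. ?c m x - g x) \<in> L2_space UNIV"
        by (rule L2_space_diff[OF conv_mollifier_contraction(1)[OF gL2] gL2])
      have "AE x in lebesgue_on \<Omega>. (weak_deriv \<Omega> ds (\<lambda>x. w x - \<psi> m x) x)\<^sup>2 = (g x - ?c m x)\<^sup>2"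
        using has_weak_deriv_unique[OF \<Omega> wd d] by eventually_elim simp
      then have "(LINT x|lebesgue_on \<Omega>. (weak_deriv \<Omega> ds (\<lambda>x. w x - \<psi> m x) x)\<^sup>2)
          = (LINT x|lebesgue_on \<Omega>. (g x - ?c m x)\<^sup>2)"
        using wd d by (intro integral_cong_AE) (auto simp: has_weak_deriv_def L2_space_def)
      also have "\<dots> = (LINT x|lebesgue. indicator \<Omega> x * (?c m x - g x)\<^sup>2)"
        unfolding integral_lebesgue_on[OF sets] by (simp add: power2_commute)
      also have "\<dots> \<le> (LINT x|lebesgue. (?c m x - g x)\<^sup>2)"
        using cL2 integrable_mult_indicator[OF sets, of "\<lambda>x. (?c m x - g x)\<^sup>2"]
        by (intro integral_mono) (auto simp: L2_space_UNIV indicator_def)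
      finally show ?thesis .
    qed
    have conv0: "(\<lambda>m. LINT x|lebesgue. (?c m x - g x)\<^sup>2) \<longlonglongrightarrow> 0"
      using LIMSEQ_ignore_initial_segment[OF conv_mollifier_L2[OF gL2], of m0] .
    show ?thesis
      by (rule tendsto_sandwich[OF _ _ tendsto_const conv0]) (auto intro!: always_eventually bound)
  qed
  have "(\<lambda>m. \<Sum>ds | set ds \<subseteq> Basis \<and> length ds \<le> k.
      LINT x|lebesgue_on \<Omega>. (weak_deriv \<Omega> ds (\<lambda>x. w x - \<psi> m x) x)\<^sup>2)
      \<longlonglongrightarrow> (\<Sum>ds :: 'a list | set ds \<subseteq> Basis \<and> length ds \<le> k. 0)"
    by (intro tendsto_sum lim) auto
  then have "(\<lambda>m. sobolev_norm k \<Omega> (\<lambda>x. w x - \<psi> m x)) \<longlonglongrightarrow> 0"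
    unfolding sobolev_norm_def using tendsto_real_sqrt by fastforce
  then show ?thesis
    using w \<psi> unfolding sobolev_space0_def w_def[symmetric] by blast
qed

section \<open>Scaling\<close>

lemma open_scaled: "open \<Omega> \<Longrightarrow> R \<noteq> 0 \<Longrightarrow> open ((\<lambda>x::'a::real_normed_vector. R *\<^sub>R x) ` \<Omega>)"
  by (rule open_scaling)

lemma scaled_mem_iff:
  "R \<noteq> 0 \<Longrightarrow> x \<in> (\<lambda>x::'a::real_vector. R *\<^sub>R x) ` \<Omega> \<longleftrightarrow> x /\<^sub>R R \<in> \<Omega>"
  by (auto simp: image_iff intro: bexI[of _ "x /\<^sub>R R"])

lemma
  fixes f :: "'a::euclidean_space \<Rightarrow> real"
  assumes \<Omega>: "open \<Omega>" and R: "R > 0" and f: "f \<in> borel_measurable (lebesgue_on \<Omega>)"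
  shows borel_measurable_scaled: "(\<lambda>x. f (x /\<^sub>R R)) \<in> borel_measurable (lebesgue_on ((\<lambda>x. R *\<^sub>R x) ` \<Omega>))"
    and integrable_scaled: "integrable (lebesgue_on \<Omega>) f \<Longrightarrow>
      integrable (lebesgue_on ((\<lambda>x. R *\<^sub>R x) ` \<Omega>)) (\<lambda>x. f (x /\<^sub>R R))"
    and integral_scaled: "(LINT x|lebesgue_on ((\<lambda>x. R *\<^sub>R x) ` \<Omega>). f (x /\<^sub>R R)) =
      R ^ DIM('a) * (LINT x|lebesgue_on \<Omega>. f x)"
proof -
  let ?S = "(\<lambda>x. R *\<^sub>R x) ` \<Omega>"
  have sets: "\<Omega> \<in> sets lebesgue" "?S \<in> sets lebesgue"
    using \<Omega> open_scaled[OF \<Omega>, of R] R by auto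
  define F where "F x = indicator \<Omega> x * f x" for x
  have F: "F \<in> borel_measurable lebesgue"
    using f sets by (simp add: F_def[abs_def] borel_measurable_restrict_space_iff)
  have F_eq: "(\<lambda>x. indicator ?S x * f (x /\<^sub>R R)) = (\<lambda>x. F (0 + inverse R *\<^sub>R x))"
    using R by (auto simp: F_def indicator_def scaled_mem_iff)
  have R': "inverse R \<noteq> 0" using R by simp
  show "(\<lambda>x. f (x /\<^sub>R R)) \<in> borel_measurable (lebesgue_on ?S)"
    using borel_measurable_lebesgue_affine[OF F R', of 0] sets unfolding F_eq[symmetric]
    by (simp add: borel_measurable_restrict_space_iff)
  show "integrable (lebesgue_on ?S) (\<lambda>x. f (x /\<^sub>R R))" if "integrable (lebesgue_on \<Omega>) f"
    using that integrable_lebesgue_affine_iff[OF F R', of 0] sets unfolding F_eq[symmetric]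
    by (simp add: integrable_restrict_space F_def[abs_def])
  have "(LINT x|lebesgue. F x) = inverse R ^ DIM('a) * (LINT x|lebesgue. indicator ?S x * f (x /\<^sub>R R))"
    using integral_lebesgue_affine[OF F R', of 0] R unfolding F_eq[symmetric] by simp
  then show "(LINT x|lebesgue_on ?S. f (x /\<^sub>R R)) = R ^ DIM('a) * (LINT x|lebesgue_on \<Omega>. f x)"
    using R unfolding integral_lebesgue_on[OF sets(1)] integral_lebesgue_on[OF sets(2)] F_def
    by (simp add: field_simps)
qed

lemma L2_space_scaled:
  fixes f :: "'a::euclidean_space \<Rightarrow> real"
  assumes "open \<Omega>" "R > 0" "f \<in> L2_space \<Omega>"
  shows "(\<lambda>x. f (x /\<^sub>R R)) \<in> L2_space ((\<lambda>x. R *\<^sub>R x) ` \<Omega>)"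
  using assms borel_measurable_scaled[OF assms(1,2), of f] integrable_scaled[OF assms(1,2), of "\<lambda>x. (f x)\<^sup>2"]
  by (simp add: L2_space_def)

lemma test_functions_affine:
  fixes \<psi> :: "'a::euclidean_space \<Rightarrow> real"
  assumes \<psi>: "\<psi> \<in> test_functions \<Omega>" and c: "c \<noteq> 0" and sub: "\<And>x. c *\<^sub>R x \<in> \<Omega> \<Longrightarrow> x \<in> \<Omega>'"
  shows "(\<lambda>x. \<psi> (c *\<^sub>R x)) \<in> test_functions \<Omega>'"
proof -
  obtain K where K: "compact K" "K \<subseteq> \<Omega>" "\<And>x. x \<notin> K \<Longrightarrow> \<psi> x = 0"
    using \<psi> by (rule test_functionsE) blast
  show ?thesis
  proof (rule test_functionsI)
    show "smooth (\<lambda>x. \<psi> (c *\<^sub>R x))"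
      using smooth_affine[OF test_functions_smooth[OF \<psi>], of 0 c] by simp
    show "compact ((\<lambda>x. inverse c *\<^sub>R x) ` K)" using K(1) by (rule compact_scaling)
    show "(\<lambda>x. inverse c *\<^sub>R x) ` K \<subseteq> \<Omega>'"
      using K(2) c by (auto intro!: sub)
    fix x assume x: "x \<notin> (\<lambda>x. inverse c *\<^sub>R x) ` K"
    have "x = inverse c *\<^sub>R (c *\<^sub>R x)" using c by simp
    with x have "c *\<^sub>R x \<notin> K" by blast
    then show "\<psi> (c *\<^sub>R x) = 0" by (rule K(3))
  qed
qed

text \<open>Substitution \<open>x \<mapsto> R x\<close> turns test functions on the scaled domain into test functions on \<open>\<Omega>\<close>, and
every derivative produces a factor \<open>R\<close>.\<close>

lemma has_weak_deriv_scaled: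
  fixes u g :: "'a::euclidean_space \<Rightarrow> real"
  assumes \<Omega>: "open \<Omega>" and R: "R > 0" and ds: "set ds \<subseteq> Basis"
    and u: "u \<in> L2_space \<Omega>" and g: "has_weak_deriv \<Omega> ds u g"
  shows "has_weak_deriv ((\<lambda>x. R *\<^sub>R x) ` \<Omega>) ds (\<lambda>x. u (x /\<^sub>R R))
    (\<lambda>x. inverse R ^ length ds * g (x /\<^sub>R R))"
  unfolding has_weak_deriv_def
proof (intro conjI ballI)
  have gL2: "g \<in> L2_space \<Omega>" using g by (simp add: has_weak_deriv_def)
  have sets: "\<Omega> \<in> sets lebesgue" using \<Omega> by simp
  show "(\<lambda>x. inverse R ^ length ds * g (x /\<^sub>R R)) \<in> L2_space ((\<lambda>x. R *\<^sub>R x) ` \<Omega>)"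
    by (intro L2_space_cmult L2_space_scaled \<Omega> R gL2)
  fix \<psi> :: "'a \<Rightarrow> real" assume \<psi>: "\<psi> \<in> test_functions ((\<lambda>x. R *\<^sub>R x) ` \<Omega>)"
  define \<xi> where "\<xi> x = \<psi> (R *\<^sub>R x)" for x
  have \<xi>: "\<xi> \<in> test_functions \<Omega>"
    unfolding \<xi>_def using R by (intro test_functions_affine[OF \<psi>]) (auto simp: scaled_mem_iff)
  have d\<xi>: "iter_partial ds \<xi> x = R ^ length ds * iter_partial ds \<psi> (R *\<^sub>R x)" for x
    using iter_partial_affine[OF test_functions_smooth[OF \<psi>] ds, of 0 R] by (simp add: \<xi>_def[abs_def])
  have cancel: "R *\<^sub>R x /\<^sub>R R = x" "R *\<^sub>R (x /\<^sub>R R) = x" for x :: 'a using R by simp_all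
  have "(LINT x|lebesgue_on ((\<lambda>x. R *\<^sub>R x) ` \<Omega>). u (x /\<^sub>R R) * iter_partial ds \<psi> x)
      = (LINT x|lebesgue_on ((\<lambda>x. R *\<^sub>R x) ` \<Omega>). inverse R ^ length ds * (u (x /\<^sub>R R) * iter_partial ds \<xi> (x /\<^sub>R R)))"
    unfolding d\<xi> cancel using R by (simp add: field_simps)
  also have "\<dots> = inverse R ^ length ds * (R ^ DIM('a) * (LINT x|lebesgue_on \<Omega>. u x * iter_partial ds \<xi> x))"
    using integrable_mult_test[OF u test_functions_iter_partial[OF \<xi> ds] sets]
    by (subst integral_mult_right_zero, subst integral_scaled[OF \<Omega> R, of "\<lambda>x. u x * iter_partial ds \<xi> x"]) auto
  also have "(LINT x|lebesgue_on \<Omega>. u x * iter_partial ds \<xi> x) = (-1) ^ length ds * (LINT x|lebesgue_on \<Omega>. g x * \<xi> x)"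
    using g \<xi> by (simp add: has_weak_deriv_def)
  also have "inverse R ^ length ds * (R ^ DIM('a) * ((-1) ^ length ds * (LINT x|lebesgue_on \<Omega>. g x * \<xi> x)))
      = (-1) ^ length ds * (inverse R ^ length ds * (LINT x|lebesgue_on ((\<lambda>x. R *\<^sub>R x) ` \<Omega>). g (x /\<^sub>R R) * \<xi> (x /\<^sub>R R)))"
    using integrable_mult_test[OF gL2 \<xi> sets]
    by (subst integral_scaled[OF \<Omega> R, of "\<lambda>x. g x * \<xi> x"]) auto
  also have "\<dots> = (-1) ^ length ds * (LINT x|lebesgue_on ((\<lambda>x. R *\<^sub>R x) ` \<Omega>). inverse R ^ length ds * g (x /\<^sub>R R) * \<psi> x)"
    unfolding \<xi>_def cancel mult.assoc by (subst integral_mult_right_zero) simp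
  finally show "(LINT x|lebesgue_on ((\<lambda>x. R *\<^sub>R x) ` \<Omega>). u (x /\<^sub>R R) * iter_partial ds \<psi> x)
      = (-1) ^ length ds * (LINT x|lebesgue_on ((\<lambda>x. R *\<^sub>R x) ` \<Omega>). inverse R ^ length ds * g (x /\<^sub>R R) * \<psi> x)" .
qed

lemma sobolev_space_scaled:
  fixes u :: "'a::euclidean_space \<Rightarrow> real"
  assumes \<Omega>: "open \<Omega>" and R: "R > 0" and u: "u \<in> sobolev_space k \<Omega>"
  shows "(\<lambda>x. u (x /\<^sub>R R)) \<in> sobolev_space k ((\<lambda>x. R *\<^sub>R x) ` \<Omega>)"
  using L2_space_scaled[OF \<Omega> R sobolev_space_L2[OF u]]
    has_weak_deriv_scaled[OF \<Omega> R _ sobolev_space_L2[OF u] has_weak_deriv_weak_deriv[OF u]]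
  unfolding sobolev_space_def by blast

section \<open>The competitor\<close>

text \<open>The indicator function of the ball of radius 3/2 is mollified at scale 1/4, which is \<open>mollifier 3\<close>.
This leaves it unchanged on the unit ball and keeps its support inside the ball of radius 2.\<close>

lemma smooth_cutoff_exists:
  shows "\<exists>\<eta>. \<eta> \<in> test_functions (ball (0::'a::euclidean_space) 2) \<and> (\<forall>x\<in>ball 0 1. \<eta> x = 1)"
proof -
  define w where "w x = indicator (ball (0::'a) (3/2)) x * (1::real)" for x
  let ?\<eta> = "conv (mollifier 3) w"
  have w_meas: "w \<in> borel_measurable lebesgue"
    unfolding w_def by (intro borel_measurable_times borel_measurable_indicator) auto
  have "integrable lebesgue (\<lambda>x. (w x)\<^sup>2)"
  proof (rule Bochner_Integration.integrable_bound[OF integrable_indicator_cball[of "3/2" 1]])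
    show "AE x in lebesgue. norm ((w x)\<^sup>2) \<le> norm (indicator (cball 0 (3 / 2)) x * (1::real))"
      by (auto simp: w_def indicator_def)
  qed (use w_meas in auto)
  with w_meas have wL2: "w \<in> L2_space UNIV" by (simp add: L2_space_UNIV)
  have "?\<eta> \<in> test_functions (ball 0 2)"
  proof (rule conv_mollifier_test_function[OF compact_cball[of 0 "3/2"] wL2])
    show "w x = 0" if "x \<notin> cball 0 (3/2)" for x using that by (simp add: w_def)
    show "cball x (1 / real (Suc 3)) \<subseteq> ball 0 2" if "x \<in> cball 0 (3/2)" for x :: 'a
    proof
      fix y assume "y \<in> cball x (1 / real (Suc 3))"
      then show "y \<in> ball 0 2"
        using that norm_triangle_sub[of y x] by (simp add: dist_norm norm_minus_commute)
    qed
  qed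
  moreover have "?\<eta> x = 1" if x: "x \<in> ball 0 1" for x
  proof -
    have "w y * mollifier 3 (x - y) = mollifier 3 (x - y)" for y
    proof (cases "x - y \<in> cball 0 (1 / real (Suc 3))")
      case True
      moreover have "norm y \<le> norm x + norm (x - y)"
        using norm_triangle_ineq4[of x "x - y"] by simp
      ultimately have "y \<in> ball 0 (3/2)" using x by simp
      then show ?thesis by (simp add: w_def)
    next
      case False
      then show ?thesis using mollifier_support[of "x - y" 3] by simp
    qed
    then have "?\<eta> x = (LINT y|lebesgue. mollifier 3 (x - y))"
      unfolding conv_def by presburger
    also have "\<dots> = 1"
      using integral_lebesgue_reflect[of "mollifier 3" x] integral_mollifier[of 3, where 'a = 'a]
      by (simp add: continuous_borel_measurable_lebesgue smooth_continuous_on smooth_mollifier)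
    finally show ?thesis .
  qed
  ultimately show ?thesis by blast
qed

lemma weak_laplacian_L2:
  fixes v :: "'a::euclidean_space \<Rightarrow> real"
  assumes "v \<in> sobolev_space 2 \<Omega>"
  shows "weak_laplacian \<Omega> v \<in> L2_space \<Omega>"
proof -
  have "(\<lambda>x. \<Sum>b\<in>B. weak_deriv \<Omega> [b, b] v x) \<in> L2_space \<Omega>" if "B \<subseteq> Basis" "finite B" for B
    using that(2,1)
  proof (induction B)
    case empty
    then show ?case by (simp add: L2_space_def)
  next
    case (insert b B)
    then have "weak_deriv \<Omega> [b, b] v \<in> L2_space \<Omega>"
      using has_weak_deriv_weak_deriv[OF assms, of "[b, b]"] by (simp add: has_weak_deriv_def)
    then show ?case using insert L2_space_add by auto
  qed
  then show ?thesis by (simp add: weak_laplacian_def[abs_def])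
qed

lemma energy_eq:
  fixes v :: "'a::euclidean_space \<Rightarrow> real"
  assumes \<Omega>: "open \<Omega>" "bounded \<Omega>" and v: "v \<in> sobolev_space 2 \<Omega>"
  shows "energy \<Omega> v = (LINT x|lebesgue_on \<Omega>. (weak_laplacian \<Omega> v x)\<^sup>2) +
    (measure lebesgue \<Omega> - measure lebesgue {x \<in> \<Omega>. v x = 0})"
    and "{x \<in> \<Omega>. v x = 0} \<in> lmeasurable"
proof -
  have meas\<Omega>: "\<Omega> \<in> lmeasurable" using \<Omega> by (simp add: lmeasurable_open)
  then have sets: "\<Omega> \<in> sets lebesgue" by simp
  have vm: "v \<in> borel_measurable (lebesgue_on \<Omega>)"
    using sobolev_space_L2[OF v] by (simp add: L2_space_def)
  have "{x \<in> space (lebesgue_on \<Omega>). v x = 0} \<in> sets (lebesgue_on \<Omega>)"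
    using vm by measurable
  then have Z: "{x \<in> \<Omega>. v x = 0} \<in> sets lebesgue"
    using sets by (simp add: sets_restrict_space_iff)
  then show Zm: "{x \<in> \<Omega>. v x = 0} \<in> lmeasurable"
    by (intro fmeasurableI2[OF meas\<Omega>]) auto
  have D: "\<Omega> - {x \<in> \<Omega>. v x = 0} \<in> lmeasurable" using meas\<Omega> Zm by (rule fmeasurable.Diff)
  have eq: "(\<lambda>x. indicator \<Omega> x * indicator {y. v y \<noteq> 0} x) = (indicator (\<Omega> - {x \<in> \<Omega>. v x = 0}) :: 'a \<Rightarrow> real)"
    by (intro ext) (auto simp: indicator_def)
  have "integrable lebesgue (indicator (\<Omega> - {x \<in> \<Omega>. v x = 0}) :: 'a \<Rightarrow> real)"
    by (rule integrable_real_indicator) (use D in \<open>simp_all only: fmeasurable_def mem_Collect_eq infinity_ennreal_def\<close>)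
  then have int2: "integrable (lebesgue_on \<Omega>) (indicator {y. v y \<noteq> 0} :: 'a \<Rightarrow> real)"
    using sets by (subst integrable_restrict_space) (simp_all add: eq)
  have "energy \<Omega> v = (LINT x|lebesgue_on \<Omega>. (weak_laplacian \<Omega> v x)\<^sup>2) +
      (LINT x|lebesgue_on \<Omega>. indicator {y. v y \<noteq> 0} x)"
    unfolding energy_def power2_abs
    by (rule Bochner_Integration.integral_add[OF _ int2])
       (use weak_laplacian_L2[OF v] in \<open>simp add: L2_space_def\<close>)
  also have "(LINT x|lebesgue_on \<Omega>. indicator {y. v y \<noteq> 0} x) = measure lebesgue (\<Omega> - {x \<in> \<Omega>. v x = 0})"
    unfolding integral_lebesgue_on[OF sets] eq using D by simp
  also have "\<dots> = measure lebesgue \<Omega> - measure lebesgue {x \<in> \<Omega>. v x = 0}"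
    using meas\<Omega> Zm by (intro measurable_measure_Diff) auto
  finally show "energy \<Omega> v = (LINT x|lebesgue_on \<Omega>. (weak_laplacian \<Omega> v x)\<^sup>2) +
    (measure lebesgue \<Omega> - measure lebesgue {x \<in> \<Omega>. v x = 0})" .
qed

text \<open>The Laplacian of the scaled function carries a factor \<open>R\<^sup>-\<^sup>2\<close>, which is squared, and the change of
variables contributes \<open>R\<^sup>n\<close>. The two choices of weak derivatives involved agree almost everywhere.\<close>

lemma weak_laplacian_scaled:
  fixes v :: "'a::euclidean_space \<Rightarrow> real"
  assumes \<Omega>: "open \<Omega>" and R: "R > 0" and v: "v \<in> sobolev_space 2 \<Omega>"
  shows "(LINT x|lebesgue_on ((\<lambda>x. R *\<^sub>R x) ` \<Omega>). (weak_laplacian ((\<lambda>x. R *\<^sub>R x) ` \<Omega>) (\<lambda>x. v (x /\<^sub>R R)) x)\<^sup>2)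
    = R powi (int DIM('a) - 4) * (LINT x|lebesgue_on \<Omega>. (weak_laplacian \<Omega> v x)\<^sup>2)"
proof -
  let ?S = "(\<lambda>x. R *\<^sub>R x) ` \<Omega>"
  let ?v = "\<lambda>x. v (x /\<^sub>R R)"
  have S: "open ?S" using \<Omega> R by (simp add: open_scaled)
  have vS: "?v \<in> sobolev_space 2 ?S" by (rule sobolev_space_scaled[OF \<Omega> R v])
  have "AE x in lebesgue_on ?S. weak_deriv ?S [b, b] ?v x = inverse R ^ 2 * weak_deriv \<Omega> [b, b] v (x /\<^sub>R R)"
    if b: "b \<in> Basis" for b
  proof -
    have "has_weak_deriv ?S [b, b] ?v (\<lambda>x. inverse R ^ length [b, b] * weak_deriv \<Omega> [b, b] v (x /\<^sub>R R))"
      by (rule has_weak_deriv_scaled[OF \<Omega> R _ sobolev_space_L2[OF v] has_weak_deriv_weak_deriv[OF v]])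
         (use b in auto)
    moreover have "has_weak_deriv ?S [b, b] ?v (weak_deriv ?S [b, b] ?v)"
      by (rule has_weak_deriv_weak_deriv[OF vS]) (use b in auto)
    ultimately show ?thesis
      using has_weak_deriv_unique[OF S] by (simp add: power2_eq_square)
  qed
  then have "AE x in lebesgue_on ?S. \<forall>b\<in>Basis. weak_deriv ?S [b, b] ?v x = inverse R ^ 2 * weak_deriv \<Omega> [b, b] v (x /\<^sub>R R)"
    by (intro AE_finite_allI) auto
  then have ae: "AE x in lebesgue_on ?S. (weak_laplacian ?S ?v x)\<^sup>2 = inverse R ^ 4 * (weak_laplacian \<Omega> v (x /\<^sub>R R))\<^sup>2"
  proof eventually_elim
    case (elim x)
    then have "weak_laplacian ?S ?v x = inverse R ^ 2 * weak_laplacian \<Omega> v (x /\<^sub>R R)"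
      by (simp add: weak_laplacian_def sum_distrib_left)
    then show ?case by (simp add: power_mult_distrib flip: power_mult)
  qed
  have L: "weak_laplacian ?S ?v \<in> borel_measurable (lebesgue_on ?S)"
      "(\<lambda>x. weak_laplacian \<Omega> v (x /\<^sub>R R)) \<in> borel_measurable (lebesgue_on ?S)"
      "weak_laplacian \<Omega> v \<in> borel_measurable (lebesgue_on \<Omega>)"
    using weak_laplacian_L2[OF vS] weak_laplacian_L2[OF v] L2_space_scaled[OF \<Omega> R weak_laplacian_L2[OF v]]
    by (simp_all add: L2_space_def)
  have "(LINT x|lebesgue_on ?S. (weak_laplacian ?S ?v x)\<^sup>2)
      = (LINT x|lebesgue_on ?S. inverse R ^ 4 * (weak_laplacian \<Omega> v (x /\<^sub>R R))\<^sup>2)"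
    using L ae by (intro integral_cong_AE) auto
  also have "\<dots> = inverse R ^ 4 * (R ^ DIM('a) * (LINT x|lebesgue_on \<Omega>. (weak_laplacian \<Omega> v x)\<^sup>2))"
    using L(3) by (subst integral_mult_right_zero, subst integral_scaled[OF \<Omega> R, of "\<lambda>x. (weak_laplacian \<Omega> v x)\<^sup>2"]) auto
  also have "inverse R ^ 4 * (R ^ DIM('a) * (LINT x|lebesgue_on \<Omega>. (weak_laplacian \<Omega> v x)\<^sup>2))
      = R powi (int DIM('a) - 4) * (LINT x|lebesgue_on \<Omega>. (weak_laplacian \<Omega> v x)\<^sup>2)"
    using R power_int_diff[of R "int DIM('a)" 4] by (simp add: field_simps)
  finally show ?thesis .
qed

theorem theorem3:
  fixes \<Omega> :: "'a::euclidean_space set" and \<phi> :: "'a \<Rightarrow> real"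
  assumes "bounded \<Omega>" and "C2_domain \<Omega>" and "ball 0 2 \<subseteq> \<Omega>"
    and "\<phi> \<in> sobolev_space 2 \<Omega>"
  shows "\<exists>C\<^sub>1\<ge>0. \<forall>R > root 4 (C\<^sub>1 / measure lebesgue (ball (0::'a) 1)).
           let \<Omega>\<^sub>R = (\<lambda>x. R *\<^sub>R x) ` \<Omega>; \<phi>\<^sub>R = (\<lambda>x. \<phi> (x /\<^sub>R R))
           in \<phi>\<^sub>R \<in> sobolev_space 2 \<Omega>\<^sub>R \<and>
              (\<forall>u. is_arg_min (energy \<Omega>\<^sub>R) (\<lambda>v. v \<in> dirichlet_class \<Omega>\<^sub>R \<phi>\<^sub>R) u \<longrightarrow>
                 measure lebesgue {x \<in> \<Omega>\<^sub>R. u x = 0} > 0 \<and>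
                 measure lebesgue {x \<in> \<Omega>\<^sub>R. u x = 0} \<ge>
                   (measure lebesgue (ball (0::'a) 1) * R ^ 4 - C\<^sub>1) * R powi (int DIM('a) - 4))"
proof -
  have \<Omega>: "open \<Omega>" using assms(2) by (simp add: C2_domain_def)
  then have sets: "\<Omega> \<in> sets lebesgue" by simp
  obtain \<eta> where \<eta>2: "\<eta> \<in> test_functions (ball (0::'a) 2)" and \<eta>1: "\<And>x. x \<in> ball 0 1 \<Longrightarrow> \<eta> x = 1"
    using smooth_cutoff_exists by blast
  have \<eta>: "\<eta> \<in> test_functions \<Omega>" by (rule test_functions_mono[OF \<eta>2 assms(3)])
  define v0 where "v0 x = \<phi> x - \<eta> x * \<phi> x" for x
  have v0: "v0 \<in> sobolev_space 2 \<Omega>"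
    unfolding v0_def by (intro sobolev_space_diff sobolev_space_mult sets assms(4) \<eta>)
  define C where "C = (LINT x|lebesgue_on \<Omega>. (weak_laplacian \<Omega> v0 x)\<^sup>2)"
  define e where "e = measure lebesgue (ball (0::'a) 1)"
  have C: "C \<ge> 0" by (simp add: C_def)
  have e: "e > 0" using content_ball_pos[of 1 "0::'a"] by (simp add: e_def)
  show ?thesis
    unfolding Let_def e_def[symmetric]
  proof (intro exI[of _ C] conjI C allI impI)
    fix R :: real assume R4: "R > root 4 (C / e)"
    have "root 4 (C / e) \<ge> 0" using C e by (simp add: real_root_ge_zero)
    then have R: "R > 0" using R4 by linarith
    have "C / e = root 4 (C / e) ^ 4" using C e by (simp add: real_root_pow_pos2)
    also have "\<dots> < R ^ 4" using R4 \<open>root 4 (C / e) \<ge> 0\<close> by (intro power_strict_mono) auto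
    finally have C_lt: "C < e * R ^ 4" using e by (simp add: field_simps)
    let ?S = "(\<lambda>x. R *\<^sub>R x) ` \<Omega>"
    let ?\<phi> = "\<lambda>x. \<phi> (x /\<^sub>R R)"
    let ?v = "\<lambda>x. v0 (x /\<^sub>R R)"
    have S: "open ?S" "bounded ?S" using \<Omega> R assms(1) by (simp_all add: open_scaled bounded_scaling)
    show \<phi>S: "?\<phi> \<in> sobolev_space 2 ?S" by (rule sobolev_space_scaled[OF \<Omega> R assms(4)])
    have vS: "?v \<in> sobolev_space 2 ?S" by (rule sobolev_space_scaled[OF \<Omega> R v0])
    \<comment> \<open>the scaled competitor differs from \<open>?\<phi>\<close> by the product of \<open>?\<phi>\<close> with this test function\<close>
    have "(\<lambda>x. - \<eta> (inverse R *\<^sub>R x)) \<in> test_functions ?S"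
      using test_functions_mult(1)[OF smooth_const[of "-1"] test_functions_affine[OF \<eta>, of "inverse R" ?S]] R
      by (simp add: scaled_mem_iff)
    from mult_test_function_sobolev_space0[OF S(1) \<phi>S this]
    have "?v \<in> dirichlet_class ?S ?\<phi>"
      using vS by (simp add: dirichlet_class_def v0_def)
    fix u assume u: "is_arg_min (energy ?S) (\<lambda>v. v \<in> dirichlet_class ?S ?\<phi>) u"
    then have uS: "u \<in> sobolev_space 2 ?S" by (simp add: is_arg_min_def dirichlet_class_def)
    have le: "energy ?S u \<le> energy ?S ?v"
      using u \<open>?v \<in> dirichlet_class ?S ?\<phi>\<close> by (auto simp: is_arg_min_def not_less)
    have "ball 0 R \<subseteq> {x \<in> ?S. ?v x = 0}"
    proof
      fix x :: 'a assume "x \<in> ball 0 R"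
      then have x: "x /\<^sub>R R \<in> ball 0 1" using R by (simp add: field_simps)
      then have "x /\<^sub>R R \<in> \<Omega>" using assms(3) by auto
      then show "x \<in> {x \<in> ?S. ?v x = 0}" using x R \<eta>1[OF x] by (simp add: scaled_mem_iff v0_def)
    qed
    then have "measure lebesgue (ball (0::'a) R) \<le> measure lebesgue {x \<in> ?S. ?v x = 0}"
      by (rule measure_mono_fmeasurable) (use energy_eq(2)[OF S vS] in auto)
    moreover have "measure lebesgue (ball (0::'a) R) = R ^ DIM('a) * e"
      using content_ball_conv_unit_ball[of R "0::'a"] R by (simp add: e_def)
    moreover have "0 \<le> (LINT x|lebesgue_on ?S. (weak_laplacian ?S u x)\<^sup>2)" by simp
    ultimately have "R ^ DIM('a) * e - R powi (int DIM('a) - 4) * C \<le> measure lebesgue {x \<in> ?S. u x = 0}"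
      using le weak_laplacian_scaled[OF \<Omega> R v0]
      unfolding energy_eq(1)[OF S uS] energy_eq(1)[OF S vS] C_def by linarith
    moreover have "R ^ DIM('a) = R powi (int DIM('a) - 4) * R ^ 4"
      using R power_int_diff[of R "int DIM('a)" 4] by simp
    ultimately show ge: "measure lebesgue {x \<in> ?S. u x = 0} \<ge> (e * R ^ 4 - C) * R powi (int DIM('a) - 4)"
      by (simp add: algebra_simps)
    have "0 < (e * R ^ 4 - C) * R powi (int DIM('a) - 4)"
      using C_lt R by simp
    with ge show "measure lebesgue {x \<in> ?S. u x = 0} > 0" by linarith
  qed
qed

end
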